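(* Let $n\ge 1$ and let $G=G_1\cup G_2$ be a graph which is a union of two subgraphs $G_1,G_2$ such that $G_1\cap G_2=H\cong K_n$. Suppose there exist $a\in V(G_1)$ and $b\in V(G_2)$ such that $a$ and $b$ are both adjacent to each vertex of $H$. If $\mathcal{N}(G_1)$ and $\mathcal{N}(G_2)$ are $(n-1)$-connected, then $\mathrm{Conn}(\mathcal{N}(G))=n-1$.
   Context: Graphs are finite, undirected, without loops or multiple edges. Unions and intersections of graphs are taken on vertex sets and edge sets. $K_n$ is the complete graph on $n$ vertices. The neighbourhood complex $\mathcal{N}(G)$ is the simplicial complex whose simplices are the subsets $\sigma\subseteq V(G)$ whose elements have a common neighbour in $G$. A (nonempty) topological space $X$ is $k$-connected if every map from the sphere $S^m$ to $X$ extends to a map from the disk $D^{m+1}$ to $X$, for $m=0,1,\dots,k$. $\mathrm{Conn}(X)$ is the largest integer $k$ such that $X$ is $k$-connected. Connectivity of a simplicial complex refers to its geometric realization. *)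

theory Defs
  imports "HOL-Analysis.Analysis"
begin

record 'a ugraph =
  verts :: "'a set"
  edges :: "'a set set"

definition simple_graph :: "'a ugraph \<Rightarrow> bool" where
  "simple_graph G \<longleftrightarrow> finite (verts G) \<and> (\<forall>e\<in>edges G. e \<subseteq> verts G \<and> card e = 2)"

definition adjacent :: "'a ugraph \<Rightarrow> 'a \<Rightarrow> 'a \<Rightarrow> bool" where
  "adjacent G u v \<longleftrightarrow> {u, v} \<in> edges G"

definition subgraph :: "'a ugraph \<Rightarrow> 'a ugraph \<Rightarrow> bool" where
  "subgraph H G \<longleftrightarrow> simple_graph H \<and> simple_graph G \<and> verts H \<subseteq> verts G \<and> edges H \<subseteq> edges G"

definition graph_union :: "'a ugraph \<Rightarrow> 'a ugraph \<Rightarrow> 'a ugraph" where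
  "graph_union G H = \<lparr>verts = verts G \<union> verts H, edges = edges G \<union> edges H\<rparr>"

definition graph_inter :: "'a ugraph \<Rightarrow> 'a ugraph \<Rightarrow> 'a ugraph" where
  "graph_inter G H = \<lparr>verts = verts G \<inter> verts H, edges = edges G \<inter> edges H\<rparr>"

definition complete_graph :: "nat \<Rightarrow> nat ugraph" where
  "complete_graph n = \<lparr>verts = {..<n}, edges = {e. e \<subseteq> {..<n} \<and> card e = 2}\<rparr>"

definition graph_isomorphic :: "'a ugraph \<Rightarrow> 'b ugraph \<Rightarrow> bool" where
  "graph_isomorphic G H \<longleftrightarrow>
     (\<exists>f. bij_betw f (verts G) (verts H) \<and>
          (\<forall>u\<in>verts G. \<forall>v\<in>verts G. adjacent G u v \<longleftrightarrow> adjacent H (f u) (f v)))"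

text \<open>The empty set is allowed as a simplex; it carries no point of the geometric realization.\<close>

definition neighbourhood_complex :: "'a ugraph \<Rightarrow> 'a set set" where
  "neighbourhood_complex G =
     {\<sigma>. \<sigma> \<subseteq> verts G \<and> (\<exists>w\<in>verts G. \<forall>v\<in>\<sigma>. adjacent G v w)}"

text \<open>
  Points are given by barycentric coordinates, and the topology is that of pointwise convergence
  of the coordinates. For complexes with finitely many vertices, the only ones considered here,
  it is the usual (weak) topology of the geometric realization.
\<close>

definition geometric_realization :: "'a set set \<Rightarrow> ('a \<Rightarrow> real) topology" where
  "geometric_realization K =
     subtopology (powertop_real UNIV)
       {x. (\<forall>v. 0 \<le> x v) \<and> {v. x v \<noteq> 0} \<in> K \<and> (\<Sum>v | x v \<noteq> 0. x v) = 1}"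

text \<open>The closed unit disk of dimension \<open>m\<close>; the boundary of \<open>ndisk (Suc m)\<close> is \<open>nsphere m\<close>.\<close>

definition ndisk :: "nat \<Rightarrow> (nat \<Rightarrow> real) topology" where
  "ndisk m = subtopology (Euclidean_space m) {x. (\<Sum>i<m. x i ^ 2) \<le> 1}"

definition k_connected :: "int \<Rightarrow> 'a topology \<Rightarrow> bool" where
  "k_connected k X \<longleftrightarrow>
     topspace X \<noteq> {} \<and>
     (\<forall>m::nat. int m \<le> k \<longrightarrow>
        (\<forall>f. continuous_map (nsphere m) X f \<longrightarrow>
           (\<exists>g. continuous_map (ndisk (Suc m)) X g \<and>
                (\<forall>x\<in>topspace (nsphere m). g x = f x))))"

text \<open>
  \<open>has_Conn X k\<close> renders \<open>Conn(X) = k\<close>. It is a relation because no largest \<open>k\<close> exists if \<open>X\<close> is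
  empty or \<open>k\<close>-connected for all \<open>k\<close>.
\<close>

definition has_Conn :: "'a topology \<Rightarrow> int \<Rightarrow> bool" where
  "has_Conn X k \<longleftrightarrow> k_connected k X \<and> (\<forall>j. k_connected j X \<longrightarrow> j \<le> k)"

end

theory Submission
  imports Defs "HOL-Homology.Brouwer_Degree"
begin

text \<open>
  Let \<open>P\<close>, \<open>Q\<close>, \<open>S\<close> be the vertices of \<open>G\<^sub>1\<close> outside \<open>H\<close>, of \<open>G\<^sub>2\<close> outside \<open>H\<close>, and of \<open>H\<close>.
  A simplex of \<open>N(G)\<close> meeting both \<open>P\<close> and \<open>Q\<close> has a common neighbour \<open>w \<in> S\<close>, so it misses \<open>w\<close> and can be
  enlarged by \<open>a\<close>, \<open>b\<close> and \<open>S - {w}\<close>.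

  Lower bound: the open sets where the total weight on \<open>Q\<close>, resp. \<open>P\<close>, is less than \<open>1\<close> cover the realization.
  They deformation retract onto \<open>N(G\<^sub>1)\<close> and \<open>N(G\<^sub>2)\<close>, and their intersection onto a copy of the boundary
  of the simplex on \<open>S \<union> {a}\<close>, an \<open>(n-1)\<close>-sphere. Two \<open>k\<close>-connected open sets with \<open>(k-1)\<close>-connected
  intersection have \<open>k\<close>-connected union: subdivide a cube so finely that every cell of its boundary is mapped
  into one of the two sets, and extend the map cell by cell.

  Upper bound: sending \<open>P\<close> to \<open>a\<close> and \<open>Q\<close> to \<open>b\<close> maps the realization to the boundary \<open>\<Sigma>\<close> of the simplex on
  \<open>S \<union> {a, b}\<close>, an \<open>n\<close>-sphere. Conversely \<open>\<Sigma>\<close> maps to the realization: the facets omitting some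
  \<open>w \<in> S\<close> are simplices of \<open>N(G)\<close>, and the facets omitting \<open>b\<close>, \<open>a\<close> are filled in inside
  \<open>N(G\<^sub>1)\<close>, \<open>N(G\<^sub>2)\<close>. The composite \<open>\<Sigma> \<rightarrow> \<Sigma>\<close> preserves every facet, hence is homotopic to the identity,
  so \<open>n\<close>-connectedness would make the sphere \<open>\<Sigma>\<close> contractible.
\<close>

section \<open>Extension of maps\<close>

lemma continuous_on_coordinate [continuous_intros]:
  fixes S :: "('a \<Rightarrow> 'b::topological_space) set"
  shows "continuous_on S (\<lambda>x. x i)"
  by (rule continuous_on_subset[OF continuous_on_product_coordinates]) simp

lemma continuous_on_Max_insert:
  fixes f :: "'i \<Rightarrow> 'a::topological_space \<Rightarrow> 'b::linorder_topology"
  assumes "finite I" and "continuous_on S g" and "\<And>i. i \<in> I \<Longrightarrow> continuous_on S (f i)"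
  shows "continuous_on S (\<lambda>x. Max (insert (g x) ((\<lambda>i. f i x) ` I)))"
  using assms(1,3)
proof (induction I)
  case empty
  then show ?case using assms(2) by simp
next
  case (insert k I)
  have "Max (insert (g x) ((\<lambda>i. f i x) ` insert k I)) = max (f k x) (Max (insert (g x) ((\<lambda>i. f i x) ` I)))" for x
    using insert.hyps by (simp add: insert_commute[of "g x"])
  then show ?case
    using insert by (auto intro!: continuous_on_max)
qed

text \<open>The pair \<open>(D, S)\<close> is kept abstract so that one property serves round balls,
  cubes, grid cells and simplices.\<close>

definition filling :: "'c::topological_space set \<Rightarrow> 'c set \<Rightarrow> 'b::topological_space set \<Rightarrow> bool" where
  "filling D S X \<longleftrightarrow>
     (\<forall>f. continuous_on S f \<and> f ` S \<subseteq> X \<longrightarrow>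
        (\<exists>g. continuous_on D g \<and> g ` D \<subseteq> X \<and> (\<forall>x\<in>S. g x = f x)))"

lemma fillingE:
  assumes "filling D S X" "continuous_on S f" "f ` S \<subseteq> X"
  obtains g where "continuous_on D g" "g ` D \<subseteq> X" "\<And>x. x \<in> S \<Longrightarrow> g x = f x"
  using assms(1)[unfolded filling_def, rule_format, OF conjI[OF assms(2,3)]] that by auto

text \<open>Extend \<open>f \<circ> \<phi>\<close> over \<open>D'\<close> and precompose with
  \<open>\<psi>\<close>. It is enough that \<open>\<phi>\<close> is a left inverse of
  \<open>\<psi>\<close> along \<open>S\<close>, so charts between the solid shapes need not be
  homeomorphisms.\<close>

lemma filling_transfer:
  assumes "filling D' S' X"
    and "continuous_on D \<psi>" "\<psi> ` D \<subseteq> D'" "\<psi> ` S \<subseteq> S'"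
    and "continuous_on S' \<phi>" "\<phi> ` S' \<subseteq> S" "\<And>x. x \<in> S \<Longrightarrow> \<phi> (\<psi> x) = x"
  shows "filling D S X"
  unfolding filling_def
proof (intro allI impI)
  fix f assume f: "continuous_on S f \<and> f ` S \<subseteq> X"
  have "continuous_on S' (f \<circ> \<phi>)"
    using f assms by (meson continuous_on_compose continuous_on_subset)
  moreover have "(f \<circ> \<phi>) ` S' \<subseteq> X" using f assms(6) by (auto simp: image_subset_iff)
  ultimately obtain g where g: "continuous_on D' g" "g ` D' \<subseteq> X" "\<And>x. x \<in> S' \<Longrightarrow> g x = (f \<circ> \<phi>) x"
    using fillingE[OF assms(1)] by metis
  have "continuous_on D (g \<circ> \<psi>)"
    using g assms by (meson continuous_on_compose continuous_on_subset)
  moreover have "(g \<circ> \<psi>) ` D \<subseteq> X" using g assms(3) by (auto simp: image_subset_iff)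
  moreover have "\<forall>x\<in>S. (g \<circ> \<psi>) x = f x" using g assms(4,7) by (auto simp: image_subset_iff)
  ultimately show "\<exists>g. continuous_on D g \<and> g ` D \<subseteq> X \<and> (\<forall>x\<in>S. g x = f x)" by blast
qed

section \<open>Unit balls of gauges\<close>

text \<open>A copy of Euclidean \<open>j\<close>-space inside the sequences, with the carrier of
  \<open>Euclidean_space j\<close>, so that balls and spheres in it can be matched with
  \<open>ndisk\<close> and \<open>nsphere\<close>.\<close>

definition coord_space :: "nat \<Rightarrow> (nat \<Rightarrow> real) set" where
  "coord_space j = {x. \<forall>i\<ge>j. x i = 0}"

text \<open>Homogeneity concerns nonnegative factors only, because \<open>simplex_gauge\<close> is
  not symmetric. No convexity is imposed: all comparisons of gauges are radial rescalings.\<close>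

definition gauge_on :: "nat \<Rightarrow> ((nat \<Rightarrow> real) \<Rightarrow> real) \<Rightarrow> bool" where
  "gauge_on j p \<longleftrightarrow> continuous_on UNIV p \<and> (\<forall>c\<ge>0. \<forall>x. p (\<lambda>i. c * x i) = c * p x) \<and>
     (\<forall>x\<in>coord_space j. x \<noteq> (\<lambda>_. 0) \<longrightarrow> 0 < p x)"

definition gauge_ball :: "nat \<Rightarrow> ((nat \<Rightarrow> real) \<Rightarrow> real) \<Rightarrow> (nat \<Rightarrow> real) set" where
  "gauge_ball j p = {x \<in> coord_space j. p x \<le> 1}"

definition gauge_sphere :: "nat \<Rightarrow> ((nat \<Rightarrow> real) \<Rightarrow> real) \<Rightarrow> (nat \<Rightarrow> real) set" where
  "gauge_sphere j p = {x \<in> coord_space j. p x = 1}"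

lemma gauge_on_scale: "gauge_on j p \<Longrightarrow> 0 \<le> c \<Longrightarrow> p (\<lambda>i. c * x i) = c * p x"
  unfolding gauge_on_def by blast

lemma gauge_on_zero: "gauge_on j p \<Longrightarrow> p (\<lambda>_. 0) = 0"
  using gauge_on_scale[of j p 0] by simp

lemma gauge_on_divide: "gauge_on j p \<Longrightarrow> 0 \<le> c \<Longrightarrow> p (\<lambda>i. x i / c) = p x / c"
  using gauge_on_scale[of j p "inverse c" x] by (simp add: divide_inverse mult.commute)

lemma gauge_on_pos: "gauge_on j p \<Longrightarrow> x \<in> coord_space j \<Longrightarrow> x \<noteq> (\<lambda>_. 0) \<Longrightarrow> 0 < p x"
  unfolding gauge_on_def by blast

lemma gauge_on_continuous: "gauge_on j p \<Longrightarrow> continuous_on S p"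
  unfolding gauge_on_def by (meson continuous_on_subset subset_UNIV)

lemma gauge_sphere_pos:
  assumes "gauge_on j p" "gauge_on j q" "x \<in> gauge_sphere j p"
  shows "0 < q x"
proof -
  have "x \<noteq> (\<lambda>_. 0)" using assms(3) gauge_on_zero[OF assms(1)] unfolding gauge_sphere_def by auto
  then show ?thesis using assms gauge_on_pos unfolding gauge_sphere_def by blast
qed

lemma coord_space_divide: "x \<in> coord_space j \<Longrightarrow> (\<lambda>i. x i / c) \<in> coord_space j"
  unfolding coord_space_def by simp

lemma gauge_normalize_continuous:
  assumes "gauge_on j p" "gauge_on j q"
  shows "continuous_on (gauge_sphere j p) (\<lambda>x i. x i / q x)"
proof (intro continuous_intros gauge_on_continuous[OF assms(2)] ballI)
  show "q x \<noteq> 0" if "x \<in> gauge_sphere j p" for x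
    using gauge_sphere_pos[OF assms that] by simp
qed

lemma gauge_normalize_mem:
  assumes "gauge_on j p" "gauge_on j q" "x \<in> gauge_sphere j p"
  shows "(\<lambda>i. x i / q x) \<in> gauge_sphere j q"
proof -
  have "0 < q x" using gauge_sphere_pos assms by blast
  then show ?thesis
    using assms gauge_on_divide[OF assms(2), of "q x" x] coord_space_divide
    unfolding gauge_sphere_def by auto
qed

lemma gauge_normalize_inverse:
  assumes "gauge_on j p" "gauge_on j q" "x \<in> gauge_sphere j p"
  shows "(\<lambda>i. (x i / q x) / p (\<lambda>i. x i / q x)) = x"
proof -
  have "0 < q x" using gauge_sphere_pos assms by blast
  then show ?thesis
    using assms gauge_on_divide[OF assms(1), of "q x" x]
    unfolding gauge_sphere_def by auto
qed

text \<open>Both maps move a point along its ray from the origin, so each undoes the other.\<close>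

lemma gauge_sphere_homeomorphic:
  assumes "gauge_on j p" "gauge_on j q"
  shows "gauge_sphere j p homeomorphic gauge_sphere j q"
  unfolding homeomorphic_minimal
  by (rule exI[of _ "\<lambda>x i. x i / q x"], rule exI[of _ "\<lambda>x i. x i / p x"])
     (intro conjI ballI gauge_normalize_continuous[OF assms] gauge_normalize_continuous[OF assms(2,1)]
        gauge_normalize_mem[OF assms] gauge_normalize_mem[OF assms(2,1)]
        gauge_normalize_inverse[OF assms] gauge_normalize_inverse[OF assms(2,1)])

text \<open>The spheres are compared by radial projection. On the \<open>p\<close>-sphere
  \<open>\<delta>\<close> is a lower bound for \<open>q\<close>, so there the truncated divisor
  \<open>max \<delta> (q x)\<close> equals \<open>q x\<close>.\<close>

lemma filling_gauge:
  assumes p: "gauge_on j p" and q: "gauge_on j q"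
    and "0 < \<delta>" and \<delta>: "\<And>x. x \<in> coord_space j \<Longrightarrow> \<delta> * p x \<le> q x"
    and "filling (gauge_ball j q) (gauge_sphere j q) X"
  shows "filling (gauge_ball j p) (gauge_sphere j p) X"
proof (rule filling_transfer[OF assms(5)])
  \<comment> \<open>Only on the sphere must this be the radial projection; the \<open>max\<close> avoids dividing by zero at the origin.\<close>
  let ?\<psi> = "\<lambda>x i. x i / max \<delta> (q x)"
  have pos: "max \<delta> (q x) > 0" for x using \<open>0 < \<delta>\<close> by simp
  show "continuous_on (gauge_ball j p) ?\<psi>"
    by (intro continuous_intros gauge_on_continuous[OF q]) (use pos in \<open>simp add: less_imp_neq[THEN not_sym]\<close>)
  show "?\<psi> ` gauge_ball j p \<subseteq> gauge_ball j q"
  proof clarify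
    fix x assume "x \<in> gauge_ball j p"
    then show "?\<psi> x \<in> gauge_ball j q"
      using gauge_on_divide[OF q, of "max \<delta> (q x)" x] pos[of x] coord_space_divide
      unfolding gauge_ball_def by simp
  qed
  have eq: "?\<psi> x = (\<lambda>i. x i / q x)" if "x \<in> gauge_sphere j p" for x
    using \<delta>[of x] that unfolding gauge_sphere_def by (simp add: max_absorb2)
  show "?\<psi> ` gauge_sphere j p \<subseteq> gauge_sphere j q"
    using eq gauge_normalize_mem[OF p q] by auto
  show "continuous_on (gauge_sphere j q) (\<lambda>x i. x i / p x)"
    by (rule gauge_normalize_continuous[OF q p])
  show "(\<lambda>x i. x i / p x) ` gauge_sphere j q \<subseteq> gauge_sphere j p"
    using gauge_normalize_mem[OF q p] by auto
  show "(\<lambda>i. ?\<psi> x i / p (?\<psi> x)) = x" if "x \<in> gauge_sphere j p" for x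
    using gauge_normalize_inverse[OF p q that] \<delta>[of x] that
    unfolding gauge_sphere_def by (simp add: max_absorb2)
qed

section \<open>Round, cubical and simplicial gauges\<close>

definition l2_gauge :: "nat \<Rightarrow> (nat \<Rightarrow> real) \<Rightarrow> real" where
  "l2_gauge j x = sqrt (\<Sum>i<j. (x i)\<^sup>2)"

definition sup_gauge :: "nat \<Rightarrow> (nat \<Rightarrow> real) \<Rightarrow> real" where
  "sup_gauge j x = Max (insert 0 ((\<lambda>i. \<bar>x i\<bar>) ` {..<j}))"

text \<open>The unit ball is the simplex given by \<open>x i \<ge> -1\<close> for
  \<open>i < j\<close> and \<open>(\<Sum>i<j. x i) \<le> 1\<close>, with the origin in its interior;
  each term of the maximum corresponds to one facet.\<close>

definition simplex_gauge :: "nat \<Rightarrow> (nat \<Rightarrow> real) \<Rightarrow> real" where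
  "simplex_gauge j x = Max (insert (\<Sum>i<j. x i) ((\<lambda>i. - x i) ` {..<j}))"

lemma Max_insert_scale:
  fixes c :: real
  assumes "0 \<le> c" "finite I"
  shows "Max (insert (c * a) ((\<lambda>i. c * f i) ` I)) = c * Max (insert a (f ` I))"
proof -
  have "mono ((*) c)" using assms by (simp add: mono_def mult_left_mono)
  from mono_Max_commute[OF this, of "insert a (f ` I)"] assms(2) show ?thesis
    by (simp add: image_image)
qed

lemma coord_space_nonzero: "x \<in> coord_space j \<Longrightarrow> x \<noteq> (\<lambda>_. 0) \<Longrightarrow> \<exists>i<j. x i \<noteq> 0"
  unfolding coord_space_def by (auto simp: fun_eq_iff) (use not_le in blast)

lemma abs_le_l2_gauge: "i < j \<Longrightarrow> \<bar>x i\<bar> \<le> l2_gauge j x"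
  unfolding l2_gauge_def
  using member_le_sum[of i "{..<j}" "\<lambda>i. (x i)\<^sup>2"] real_sqrt_le_mono by fastforce

lemma gauge_on_l2: "gauge_on j (l2_gauge j)"
  unfolding gauge_on_def
proof (intro conjI allI impI ballI)
  show "continuous_on UNIV (l2_gauge j)"
    unfolding l2_gauge_def by (intro continuous_intros)
  show "l2_gauge j (\<lambda>i. c * x i) = c * l2_gauge j x" if "0 \<le> c" for c x
    using that unfolding l2_gauge_def
    by (simp add: power_mult_distrib sum_distrib_left[symmetric] real_sqrt_mult)
  show "0 < l2_gauge j x" if "x \<in> coord_space j" "x \<noteq> (\<lambda>_. 0)" for x
    using coord_space_nonzero[OF that] abs_le_l2_gauge[of _ j x] by fastforce
qed

lemma gauge_on_sup: "gauge_on j (sup_gauge j)"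
  unfolding gauge_on_def
proof (intro conjI allI impI ballI)
  show "continuous_on UNIV (sup_gauge j)"
    unfolding sup_gauge_def by (intro continuous_on_Max_insert continuous_intros) auto
  show "sup_gauge j (\<lambda>i. c * x i) = c * sup_gauge j x" if "0 \<le> c" for c x
    using that Max_insert_scale[of c "{..<j}" 0 "\<lambda>i. \<bar>x i\<bar>"] unfolding sup_gauge_def
    by (simp add: abs_mult)
  show "0 < sup_gauge j x" if "x \<in> coord_space j" "x \<noteq> (\<lambda>_. 0)" for x
    using coord_space_nonzero[OF that] unfolding sup_gauge_def by (force simp: Max_gr_iff)
qed

lemma gauge_on_simplex: "gauge_on j (simplex_gauge j)"
  unfolding gauge_on_def
proof (intro conjI allI impI ballI)
  show "continuous_on UNIV (simplex_gauge j)"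
    unfolding simplex_gauge_def by (intro continuous_on_Max_insert continuous_intros) auto
  show "simplex_gauge j (\<lambda>i. c * x i) = c * simplex_gauge j x" if "0 \<le> c" for c x
    using that Max_insert_scale[of c "{..<j}" "\<Sum>i<j. x i" "\<lambda>i. - x i"] unfolding simplex_gauge_def
    by (simp add: sum_distrib_left)
  show "0 < simplex_gauge j x" if x: "x \<in> coord_space j" "x \<noteq> (\<lambda>_. 0)" for x
  proof (rule ccontr)
    assume "\<not> 0 < simplex_gauge j x"
    \<comment> \<open>A nonpositive gauge means nonnegative coordinates with a nonpositive sum,
      which forces all of them to vanish.\<close>
    then have 1: "(\<Sum>i<j. x i) \<le> 0" "\<And>i. i < j \<Longrightarrow> 0 \<le> x i"
      unfolding simplex_gauge_def by (auto simp: Max_gr_iff not_less)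
    then have "\<forall>i\<in>{..<j}. x i = 0"
      using sum_nonneg_eq_0_iff[of "{..<j}" x] sum_nonneg[of "{..<j}" x] by force
    then show False using coord_space_nonzero[OF x] by auto
  qed
qed

lemma sup_le_l2_gauge: "sup_gauge j x \<le> l2_gauge j x"
  unfolding sup_gauge_def
  by (rule Max.boundedI) (use abs_le_l2_gauge[of _ j x] in \<open>auto simp: l2_gauge_def sum_nonneg\<close>)

lemma abs_le_sup_gauge: "i < j \<Longrightarrow> \<bar>x i\<bar> \<le> sup_gauge j x"
  unfolding sup_gauge_def by (rule Max_ge) auto

text \<open>The factor is crude, but unlike \<open>real j\<close> it is positive for
  \<open>j = 0\<close> too, so its inverse can serve as \<open>\<delta>\<close> in
  \<open>filling_gauge\<close>.\<close>

lemma l2_le_sup_gauge: "l2_gauge j x \<le> (real j + 1) * sup_gauge j x"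
proof -
  have s: "0 \<le> sup_gauge j x" unfolding sup_gauge_def by (rule Max_ge) auto
  have "l2_gauge j x \<le> (\<Sum>i<j. \<bar>x i\<bar>)"
    using L2_set_le_sum_abs[of x "{..<j}"] unfolding l2_gauge_def L2_set_def .
  also have "\<dots> \<le> (\<Sum>i<j. sup_gauge j x)"
    by (rule sum_mono) (simp add: abs_le_sup_gauge)
  also have "\<dots> \<le> (real j + 1) * sup_gauge j x"
    using s by (simp add: algebra_simps)
  finally show ?thesis .
qed

lemma simplex_le_l2_gauge: "simplex_gauge j x \<le> (real j + 1) * l2_gauge j x"
proof -
  have s: "0 \<le> l2_gauge j x" by (simp add: l2_gauge_def sum_nonneg)
  have "(\<Sum>i<j. x i) \<le> (\<Sum>i<j. l2_gauge j x)"
    by (rule sum_mono) (metis abs_le_l2_gauge abs_le_D1 lessThan_iff)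
  also have "\<dots> \<le> (real j + 1) * l2_gauge j x" using s by (simp add: algebra_simps)
  finally have 1: "(\<Sum>i<j. x i) \<le> (real j + 1) * l2_gauge j x" .
  have 2: "- x i \<le> (real j + 1) * l2_gauge j x" if "i < j" for i
    using abs_le_l2_gauge[OF that, of x] mult_nonneg_nonneg[OF of_nat_0_le_iff[of j] s]
    unfolding distrib_right by linarith
  show ?thesis
    unfolding simplex_gauge_def by (rule Max.boundedI) (use 1 2 in auto)
qed

section \<open>Connectivity of subspaces\<close>

text \<open>For \<open>j = 0\<close> the sphere is empty and the condition says that \<open>X\<close> is nonempty.\<close>

definition fillable :: "nat \<Rightarrow> 'b::topological_space set \<Rightarrow> bool" where
  "fillable j X \<longleftrightarrow> filling (gauge_ball j (l2_gauge j)) (gauge_sphere j (l2_gauge j)) X"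

lemma filling_cube_iff:
  "filling (gauge_ball j (sup_gauge j)) (gauge_sphere j (sup_gauge j)) X \<longleftrightarrow> fillable j X"
proof
  show "fillable j X" if "filling (gauge_ball j (sup_gauge j)) (gauge_sphere j (sup_gauge j)) X"
    unfolding fillable_def
    by (rule filling_gauge[OF gauge_on_l2 gauge_on_sup _ _ that, of "1 / (real j + 1)"])
       (use l2_le_sup_gauge in \<open>auto simp: field_simps\<close>)
  show "filling (gauge_ball j (sup_gauge j)) (gauge_sphere j (sup_gauge j)) X" if "fillable j X"
    by (rule filling_gauge[OF gauge_on_sup gauge_on_l2 _ _ that[unfolded fillable_def], of 1])
       (use sup_le_l2_gauge in auto)
qed

lemma filling_simplex_gauge:
  assumes "fillable j X"
  shows "filling (gauge_ball j (simplex_gauge j)) (gauge_sphere j (simplex_gauge j)) X"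
  by (rule filling_gauge[OF gauge_on_simplex gauge_on_l2 _ _ assms[unfolded fillable_def], of "1 / (real j + 1)"])
     (use simplex_le_l2_gauge in \<open>auto simp: field_simps\<close>)

lemma gauge_ball_l2: "gauge_ball j (l2_gauge j) = {x. (\<forall>i\<ge>j. x i = 0) \<and> (\<Sum>i<j. (x i)\<^sup>2) \<le> 1}"
  by (auto simp: gauge_ball_def coord_space_def l2_gauge_def)

lemma gauge_sphere_l2: "gauge_sphere j (l2_gauge j) = {x. (\<forall>i\<ge>j. x i = 0) \<and> (\<Sum>i<j. (x i)\<^sup>2) = 1}"
  by (auto simp: gauge_sphere_def coord_space_def l2_gauge_def)

lemma ndisk_eq: "ndisk j = top_of_set (gauge_ball j (l2_gauge j))"
  unfolding ndisk_def Euclidean_space_def euclidean_product_topology subtopology_subtopology gauge_ball_l2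
  by (simp add: Collect_conj_eq)

lemma nsphere_eq: "nsphere j = top_of_set (gauge_sphere (Suc j) (l2_gauge (Suc j)))"
  unfolding nsphere_def Euclidean_space_def euclidean_product_topology subtopology_subtopology gauge_sphere_l2
  by (simp add: Collect_conj_eq lessThan_Suc_atMost)

lemma gauge_sphere_0 [simp]: "gauge_sphere 0 (l2_gauge 0) = {}"
  by (auto simp: gauge_sphere_l2)

lemma gauge_ball_0: "gauge_ball 0 (l2_gauge 0) = {\<lambda>_. 0}"
  by (auto simp: gauge_ball_l2)

lemma fillable_0: "fillable 0 X \<longleftrightarrow> X \<noteq> {}"
  unfolding fillable_def filling_def gauge_ball_0
  by (auto intro: exI[of _ "\<lambda>_. SOME x. x \<in> X"] simp: some_in_eq)

text \<open>The index counts disk dimensions: \<open>fillable (Suc m)\<close> extends maps from the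
  \<open>m\<close>-sphere, and \<open>fillable 0\<close> is nonemptiness. Hence
  \<open>(n-1)\<close>-connectedness covers all degrees up to \<open>n\<close>.\<close>

lemma k_connected_iff_fillable:
  "k_connected (int n - 1) (top_of_set X) \<longleftrightarrow> (\<forall>j\<le>n. fillable j X)"
proof -
  have "(\<forall>j\<le>n. fillable j X) \<longleftrightarrow> fillable 0 X \<and> (\<forall>m<n. fillable (Suc m) X)"
    by (metis Suc_le_eq not0_implies_Suc zero_le)
  moreover have "fillable (Suc m) X \<longleftrightarrow>
        (\<forall>f. continuous_map (nsphere m) (top_of_set X) f \<longrightarrow>
           (\<exists>g. continuous_map (ndisk (Suc m)) (top_of_set X) g \<and>
                (\<forall>x\<in>topspace (nsphere m). g x = f x)))" for m
    unfolding fillable_def filling_def ndisk_eq nsphere_eq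
    by (simp add: Pi_iff image_subset_iff)
  moreover have "int m \<le> int n - 1 \<longleftrightarrow> m < n" for m by auto
  ultimately show ?thesis
    unfolding k_connected_def fillable_0 by simp
qed

lemma closed_coord_space: "closed (coord_space j)"
proof -
  have "coord_space j = (\<Inter>i\<in>{j..}. {x. x i = 0})" by (auto simp: coord_space_def)
  then show ?thesis by (auto intro!: closed_INT closed_Collect_eq continuous_intros)
qed

text \<open>A sphere in \<open>U\<close> is pushed into \<open>X\<close> by \<open>p\<close>, filled
  there and brought back by \<open>i\<close>; the homotopy from \<open>i \<circ> p\<close> to the
  identity supplies a collar that restores the original boundary values.\<close>

lemma fillable_dominated:
  fixes X :: "'b::topological_space set" and U :: "'c::topological_space set"
  assumes "fillable j X"
    and p: "continuous_on U p" "p ` U \<subseteq> X"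
    and i: "continuous_on X i" "i ` X \<subseteq> U"
    and h: "continuous_on ({0..1::real} \<times> U) h" "h ` ({0..1} \<times> U) \<subseteq> U"
      "\<And>x. x \<in> U \<Longrightarrow> h (0, x) = i (p x)" "\<And>x. x \<in> U \<Longrightarrow> h (1, x) = x"
  shows "fillable j U"
  unfolding fillable_def filling_def
proof (intro allI impI, elim conjE)
  let ?B = "gauge_ball j (l2_gauge j)" and ?S = "gauge_sphere j (l2_gauge j)"
  let ?n = "l2_gauge j"
  fix f assume f: "continuous_on ?S f" "f ` ?S \<subseteq> U"
  have "continuous_on ?S (p \<circ> f)"
    by (rule continuous_on_compose[OF f(1) continuous_on_subset[OF p(1) f(2)]])
  moreover have "(p \<circ> f) ` ?S \<subseteq> X"
    using f p by (auto simp: image_subset_iff)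
  ultimately obtain g where g: "continuous_on ?B g" "g ` ?B \<subseteq> X" "\<And>x. x \<in> ?S \<Longrightarrow> g x = p (f x)"
    using fillingE[OF assms(1)[unfolded fillable_def], of "p \<circ> f"] by auto
  \<comment> \<open>The inner ball of radius 1/2 carries the filling in \<open>X\<close>, the outer
    shell the collar. Where they meet, \<open>x / ?n x = 2 * x\<close> and the homotopy is at time
    0, so the two formulas agree.\<close>
  let ?B1 = "?B \<inter> {x. ?n x \<le> 1/2}" and ?B2 = "?B \<inter> {x. 1/2 \<le> ?n x}"
  let ?g1 = "\<lambda>x. i (g (\<lambda>k. 2 * x k))" and ?g2 = "\<lambda>x. h (2 * ?n x - 1, f (\<lambda>k. x k / ?n x))"
  let ?G = "\<lambda>x. if 1/2 \<le> ?n x then ?g2 x else ?g1 x"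
  have nc: "continuous_on S ?n" for S by (rule gauge_on_continuous[OF gauge_on_l2])
  have ball: "?B = coord_space j \<inter> {x. ?n x \<le> 1}" by (auto simp: gauge_ball_def)
  have cl: "closed ?B1" "closed ?B2"
    unfolding ball by (intro closed_Int closed_coord_space closed_Collect_le nc continuous_intros)+
  have dbl: "(\<lambda>k. 2 * x k) \<in> ?B" if "x \<in> ?B1" for x
    using that gauge_on_scale[OF gauge_on_l2, of 2 j x] by (auto simp: gauge_ball_def coord_space_def)
  have nrm: "(\<lambda>k. x k / ?n x) \<in> ?S" if "x \<in> ?B2" for x
    using that gauge_on_divide[OF gauge_on_l2, of "?n x" j x] coord_space_divide[of x j]
    by (auto simp: gauge_ball_def gauge_sphere_def)
  have c1: "continuous_on ?B1 ?g1"
  proof (rule continuous_on_compose2[OF i(1)])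
    show "continuous_on ?B1 (\<lambda>x. g (\<lambda>k. 2 * x k))"
      by (rule continuous_on_compose2[OF g(1)]) (use dbl in \<open>auto intro!: continuous_intros\<close>)
  qed (use dbl g(2) in blast)
  have c2: "continuous_on ?B2 ?g2"
  proof (rule continuous_on_compose2[OF h(1)])
    have "continuous_on ?B2 (\<lambda>x. f (\<lambda>k. x k / ?n x))"
      by (rule continuous_on_compose2[OF f(1)]) (use nrm in \<open>auto intro!: continuous_intros nc\<close>)
    then show "continuous_on ?B2 (\<lambda>x. (2 * ?n x - 1, f (\<lambda>k. x k / ?n x)))"
      by (intro continuous_intros nc)
    show "(\<lambda>x. (2 * ?n x - 1, f (\<lambda>k. x k / ?n x))) ` ?B2 \<subseteq> {0..1} \<times> U"
    proof (rule image_subsetI)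
      fix x assume x: "x \<in> ?B2"
      then show "(2 * ?n x - 1, f (\<lambda>k. x k / ?n x)) \<in> {0..1} \<times> U"
        using nrm[of x] f(2) by (auto simp: gauge_ball_def)
    qed
  qed
  have mid: "?g1 x = ?g2 x" if "x \<in> ?B" "?n x = 1/2" for x
  proof -
    have y: "(\<lambda>k. x k / ?n x) = (\<lambda>k. 2 * x k)" unfolding that(2) by (simp add: fun_eq_iff)
    have S: "(\<lambda>k. 2 * x k) \<in> ?S" unfolding y[symmetric] by (rule nrm) (use that in simp)
    have "2 * ?n x - 1 = 0" using that(2) by simp
    then have "?g2 x = h (0, f (\<lambda>k. 2 * x k))" unfolding y by (simp only:)
    then show ?thesis using g(3)[OF S] h(3)[of "f (\<lambda>k. 2 * x k)"] f(2) S by auto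
  qed
  have "continuous_on (?B2 \<union> ?B1) ?G"
    by (rule continuous_on_cases[OF cl(2,1) c2 c1]) (use mid in \<open>auto simp: order_antisym_conv\<close>)
  moreover have "?B2 \<union> ?B1 = ?B" by auto
  ultimately have "continuous_on ?B ?G" by simp
  moreover have "?G ` ?B \<subseteq> U"
  proof (rule image_subsetI)
    fix x assume x: "x \<in> ?B"
    show "?G x \<in> U"
    proof (cases "1/2 \<le> ?n x")
      case True
      then have "f (\<lambda>k. x k / ?n x) \<in> U" using nrm[of x] x f(2) by auto
      moreover have "2 * ?n x - 1 \<in> {0..1}" using True x by (auto simp: gauge_ball_def)
      ultimately show ?thesis using h(2) True by auto
    next
      case False
      then have "g (\<lambda>k. 2 * x k) \<in> X" using dbl[of x] x g(2) by auto
      then show ?thesis using False i(2) by auto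
    qed
  qed
  moreover have "?G x = f x" if "x \<in> ?S" for x
  proof -
    have "f x \<in> U" using f(2) that by blast
    moreover have "?n x = 1" using that by (simp add: gauge_sphere_def)
    ultimately show ?thesis using h(4) by simp
  qed
  ultimately show "\<exists>g. continuous_on ?B g \<and> g ` ?B \<subseteq> U \<and> (\<forall>x\<in>?S. g x = f x)"
    by (intro exI[of _ ?G] conjI ballI)
qed

definition segment_point :: "real \<Rightarrow> ('a \<Rightarrow> real) \<Rightarrow> ('a \<Rightarrow> real) \<Rightarrow> 'a \<Rightarrow> real" where
  "segment_point t x y = (\<lambda>v. (1 - t) * x v + t * y v)"

lemma continuous_on_segment_point [continuous_intros]:
  assumes "continuous_on S c" "continuous_on S f" "continuous_on S g"
  shows "continuous_on S (\<lambda>z. segment_point (c z) (f z) (g z))"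
  unfolding segment_point_def
  by (rule continuous_on_coordinatewise_then_product)
     (intro continuous_intros assms(1) assms(2,3)[THEN continuous_on_product_then_coordinatewise])

text \<open>The deformations used for subspaces of realizations are all straight-line homotopies, so
  only the containment of segments in \<open>U\<close> is left to check.\<close>

lemma fillable_dominated_segment:
  fixes X :: "'b::topological_space set" and U :: "('a \<Rightarrow> real) set"
  assumes "fillable j X"
    and p: "continuous_on U p" "p ` U \<subseteq> X"
    and i: "continuous_on X i" "i ` X \<subseteq> U"
    and seg: "\<And>x t. x \<in> U \<Longrightarrow> 0 \<le> t \<Longrightarrow> t \<le> 1 \<Longrightarrow> segment_point t (i (p x)) x \<in> U"
  shows "fillable j U"
proof (rule fillable_dominated[OF assms(1) p i])
  have "continuous_on ({0..1::real} \<times> U) (\<lambda>z. i (p (snd z)))"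
    by (rule continuous_on_compose2[OF i(1)], rule continuous_on_compose2[OF p(1)])
       (use p in \<open>auto intro: continuous_intros\<close>)
  then show "continuous_on ({0..1::real} \<times> U) (\<lambda>z. segment_point (fst z) (i (p (snd z))) (snd z))"
    by (intro continuous_on_segment_point continuous_on_fst continuous_on_snd continuous_on_id)
qed (use seg in \<open>auto simp: segment_point_def\<close>)

lemma fillable_singleton: "fillable j {c}"
  unfolding fillable_def filling_def
  by (auto intro!: exI[of _ "\<lambda>_. c"] simp: image_subset_iff)

section \<open>Gluing along open sets\<close>

text \<open>
  \<open>T e\<close> is the subspace to which the map is confined on the cell \<open>e\<close>; the boundary of \<open>e\<close> is the
  union of the cells properly contained in it.
\<close>

lemma cell_extension:
  fixes C :: "'c::topological_space set set" and T :: "'c set \<Rightarrow> 'b::topological_space set"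
  assumes "finite C" and closed: "\<And>e. e \<in> C \<Longrightarrow> closed e"
    and inter: "\<And>e e'. e \<in> C \<Longrightarrow> e' \<in> C \<Longrightarrow> e \<inter> e' \<noteq> {} \<Longrightarrow> e \<inter> e' \<in> C"
    and fill: "\<And>e. e \<in> C \<Longrightarrow> filling e (\<Union>{e' \<in> C. e' \<subset> e}) (T e)"
    and mono: "\<And>e e'. e \<in> C \<Longrightarrow> e' \<in> C \<Longrightarrow> e \<subset> e' \<Longrightarrow> T e \<subseteq> T e'"
    and "A \<subseteq> C" "\<And>e e'. e \<in> C \<Longrightarrow> e' \<in> A \<Longrightarrow> e \<subset> e' \<Longrightarrow> e \<in> A"
    and "continuous_on (\<Union>A) f" "\<And>e. e \<in> A \<Longrightarrow> f ` e \<subseteq> T e"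
  shows "\<exists>g. continuous_on (\<Union>C) g \<and> (\<forall>x\<in>\<Union>A. g x = f x) \<and> (\<forall>e\<in>C. g ` e \<subseteq> T e)"
  using assms(6-9)
proof (induction "card (C - A)" arbitrary: A f)
  case 0
  then have "A = C" using \<open>finite C\<close> by auto
  with 0 show ?case by blast
next
  case (Suc k)
  then have "finite (C - A)" "C - A \<noteq> {}" using \<open>finite C\<close> by auto
  \<comment> \<open>By minimality every proper face of \<open>e\<close> already lies in
    \<open>A\<close>, so \<open>f\<close> is defined on the whole boundary of
    \<open>e\<close>.\<close>
  then obtain e where e: "e \<in> C - A" "\<And>e'. e' \<in> C - A \<Longrightarrow> \<not> e' \<subset> e"
    using finite_has_minimal[of "C - A"] by (metis psubset_eq)
  let ?b = "\<Union>{e' \<in> C. e' \<subset> e}"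
  have bA: "{e' \<in> C. e' \<subset> e} \<subseteq> A" using e by blast
  have "continuous_on ?b f"
    by (rule continuous_on_subset[OF Suc.prems(3)]) (use bA in blast)
  moreover have "f ` ?b \<subseteq> T e"
  proof (rule image_subsetI)
    fix x assume "x \<in> ?b"
    then obtain e' where "x \<in> e'" "e' \<in> C" "e' \<subset> e" by blast
    then show "f x \<in> T e" using bA Suc.prems(4)[of e'] mono[of e' e] e by blast
  qed
  moreover have "filling e ?b (T e)" using fill e by blast
  ultimately obtain g where g: "continuous_on e g" "g ` e \<subseteq> T e" "\<And>x. x \<in> ?b \<Longrightarrow> g x = f x"
    using fillingE[of e ?b "T e" f] by blast
  let ?f = "\<lambda>x. if x \<in> e then g x else f x"
  \<comment> \<open>The new cell meets an old one only in its own boundary: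
    \<open>e \<inter> e'\<close> is a cell, and it is proper in \<open>e\<close> because
    \<open>A\<close> is closed under faces and does not contain \<open>e\<close>. Hence
    \<open>g\<close> and \<open>f\<close> agree on the overlap.\<close>
  have eA: "x \<in> ?b" if x: "x \<in> e" "e' \<in> A" "x \<in> e'" for x e'
  proof -
    have "e \<inter> e' \<in> C" using inter[of e e'] x e Suc.prems(1) by blast
    moreover have "\<not> e \<subseteq> e'"
      using x e Suc.prems(2)[of e e'] by (metis DiffD1 DiffD2 psubsetI)
    ultimately show ?thesis using x by blast
  qed
  have clA: "closed (\<Union>A)"
    using Suc.prems(1) \<open>finite C\<close> closed by (meson closed_Union finite_subset subsetD)
  have ce: "closed e" using e closed by blast
  have "g x = f x" if "x \<in> e" "e' \<in> A" "x \<in> e'" for x e'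
    by (rule g(3)[OF eA[OF that]])
  then have "continuous_on (e \<union> \<Union>A) ?f"
    by (intro continuous_on_cases[OF ce clA g(1) Suc.prems(3)]) blast
  then have 1: "continuous_on (\<Union>(insert e A)) ?f" by simp
  have agree: "?f x = f x" if "x \<in> e'" "e' \<in> A" for x e'
    using g(3)[OF eA[OF _ that(2,1)]] by simp
  have "\<exists>g. continuous_on (\<Union>C) g \<and> (\<forall>x\<in>\<Union>(insert e A). g x = ?f x) \<and> (\<forall>e\<in>C. g ` e \<subseteq> T e)"
  proof (rule Suc.hyps(1)[OF _ _ _ 1])
    have "C - insert e A = (C - A) - {e}" by blast
    then show "k = card (C - insert e A)"
      using Suc.hyps(2) e \<open>finite (C - A)\<close> by simp
    show "insert e A \<subseteq> C" using e Suc.prems(1) by blast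
    show "e1 \<in> insert e A" if "e1 \<in> C" "e' \<in> insert e A" "e1 \<subset> e'" for e1 e'
      using that e Suc.prems(2)[of e1 e'] by blast
    show "?f ` e' \<subseteq> T e'" if "e' \<in> insert e A" for e'
    proof (cases "e' = e")
      case True
      then show ?thesis using g(2) by auto
    next
      case False
      then have "e' \<in> A" using that by simp
      show ?thesis
      proof (rule image_subsetI)
        fix x assume "x \<in> e'"
        then show "?f x \<in> T e'"
          using agree[OF _ \<open>e' \<in> A\<close>] Suc.prems(4)[OF \<open>e' \<in> A\<close>] by (metis image_subset_iff)
      qed
    qed
  qed
  then obtain G where G: "continuous_on (\<Union>C) G" "\<forall>x\<in>\<Union>(insert e A). G x = ?f x"
      "\<forall>e\<in>C. G ` e \<subseteq> T e"
    by (elim exE conjE)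
  have "\<forall>x\<in>\<Union>A. G x = f x"
  proof
    fix x assume x: "x \<in> \<Union>A"
    then obtain e' where "x \<in> e'" "e' \<in> A" by blast
    then show "G x = f x" using G(2) agree[of x e'] x by simp
  qed
  with G(1,3) show ?case by (intro exI[of _ G] conjI)
qed

section \<open>Cubical subdivision of the unit cube\<close>

definition grid_cell :: "nat \<Rightarrow> nat \<Rightarrow> (nat \<Rightarrow> nat) \<Rightarrow> (nat \<Rightarrow> nat) \<Rightarrow> (nat \<Rightarrow> real) set" where
  "grid_cell N d l w =
     {x \<in> coord_space d. \<forall>i<d. real (l i) \<le> real N * x i \<and> real N * x i \<le> real (l i + w i)}"

text \<open>Lower corners \<open>l\<close> and widths \<open>w\<close> are measured in units of
  \<open>1/N\<close>. Cells of all dimensions are included, the dimension being the number of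
  \<open>i < d\<close> with \<open>w i = 1\<close>.\<close>

definition grid :: "nat \<Rightarrow> nat \<Rightarrow> (nat \<Rightarrow> real) set set" where
  "grid N d = {grid_cell N d l w | l w. \<forall>i<d. w i \<le> 1 \<and> l i + w i \<le> N}"

definition unit_cube :: "nat \<Rightarrow> (nat \<Rightarrow> real) set" where
  "unit_cube d = {x \<in> coord_space d. \<forall>i<d. 0 \<le> x i \<and> x i \<le> 1}"

definition cube_boundary :: "nat \<Rightarrow> (nat \<Rightarrow> real) set" where
  "cube_boundary d = {x \<in> unit_cube d. \<exists>i<d. x i = 0 \<or> x i = 1}"

text \<open>The cell is degenerate in the directions \<open>i\<close> with \<open>w i = 0\<close>; these do not contribute to its boundary.\<close>

definition cell_boundary :: "nat \<Rightarrow> nat \<Rightarrow> (nat \<Rightarrow> nat) \<Rightarrow> (nat \<Rightarrow> nat) \<Rightarrow> (nat \<Rightarrow> real) set" where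
  "cell_boundary N d l w =
     {x \<in> grid_cell N d l w. \<exists>i<d. w i = 1 \<and> (real N * x i = real (l i) \<or> real N * x i = real (l i + 1))}"

lemma gridI: "(\<And>i. i < d \<Longrightarrow> w i \<le> 1) \<Longrightarrow> (\<And>i. i < d \<Longrightarrow> l i + w i \<le> N) \<Longrightarrow> grid_cell N d l w \<in> grid N d"
  unfolding grid_def by blast

lemma gridE:
  assumes "e \<in> grid N d"
  obtains l w where "e = grid_cell N d l w" "\<And>i. i < d \<Longrightarrow> w i \<le> 1" "\<And>i. i < d \<Longrightarrow> l i + w i \<le> N"
proof -
  obtain l w where "e = grid_cell N d l w \<and> (\<forall>i<d. w i \<le> 1 \<and> l i + w i \<le> N)"
    using assms unfolding grid_def by blast
  then show ?thesis using that[of l w] by simp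
qed

lemma grid_cell_cong:
  "(\<And>i. i < d \<Longrightarrow> l i = l' i) \<Longrightarrow> (\<And>i. i < d \<Longrightarrow> w i = w' i) \<Longrightarrow> grid_cell N d l w = grid_cell N d l' w'"
  unfolding grid_cell_def by auto

lemma finite_grid: "finite (grid N d)"
proof (rule finite_subset)
  show "grid N d \<subseteq> (\<lambda>(l, w). grid_cell N d l w) ` (({..<d} \<rightarrow>\<^sub>E {..N}) \<times> ({..<d} \<rightarrow>\<^sub>E {..1}))"
  proof
    fix e assume "e \<in> grid N d"
    then obtain l w where lw: "e = grid_cell N d l w" "\<And>i. i < d \<Longrightarrow> w i \<le> 1" "\<And>i. i < d \<Longrightarrow> l i + w i \<le> N"
      using gridE by metis
    \<comment> \<open>Values of \<open>l\<close> and \<open>w\<close> at indices from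
      \<open>d\<close> on do not affect the cell; cutting them off places the pair in a finite
      product of function spaces.\<close>
    have "e = grid_cell N d (restrict l {..<d}) (restrict w {..<d})"
      unfolding lw(1) by (rule grid_cell_cong) auto
    moreover have "restrict l {..<d} \<in> {..<d} \<rightarrow>\<^sub>E {..N}" "restrict w {..<d} \<in> {..<d} \<rightarrow>\<^sub>E {..1}"
      using lw(2,3) by (auto intro: add_leD1)
    ultimately show "e \<in> (\<lambda>(l, w). grid_cell N d l w) ` (({..<d} \<rightarrow>\<^sub>E {..N}) \<times> ({..<d} \<rightarrow>\<^sub>E {..1}))"
      by (intro image_eqI[where x = "(restrict l {..<d}, restrict w {..<d})"]) simp_all
  qed
qed (auto intro!: finite_PiE finite_cartesian_product)

lemma closed_grid_cell: "closed (grid_cell N d l w)"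
proof -
  have "grid_cell N d l w = coord_space d \<inter>
      (\<Inter>i\<in>{..<d}. {x. real (l i) \<le> real N * x i} \<inter> {x. real N * x i \<le> real (l i + w i)})"
    unfolding grid_cell_def by auto
  then show ?thesis
    by (auto intro!: closed_Int closed_coord_space closed_INT closed_Collect_le continuous_intros)
qed

lemma grid_Int:
  assumes "e \<in> grid N d" "e' \<in> grid N d" "e \<inter> e' \<noteq> {}"
  shows "e \<inter> e' \<in> grid N d"
proof -
  obtain l w where e: "e = grid_cell N d l w" "\<And>i. i < d \<Longrightarrow> w i \<le> 1" "\<And>i. i < d \<Longrightarrow> l i + w i \<le> N"
    using gridE[OF assms(1)] by metis
  obtain l' w' where e': "e' = grid_cell N d l' w'" "\<And>i. i < d \<Longrightarrow> w' i \<le> 1" "\<And>i. i < d \<Longrightarrow> l' i + w' i \<le> N"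
    using gridE[OF assms(2)] by metis
  let ?m = "\<lambda>i. max (l i) (l' i)" and ?M = "\<lambda>i. min (l i + w i) (l' i + w' i)"
  obtain x where x: "x \<in> e" "x \<in> e'" using assms(3) by blast
  \<comment> \<open>A common point makes the intersection of the two intervals nonempty, so the
    truncated subtraction \<open>?M i - ?m i\<close> is the true width.\<close>
  have le: "?m i \<le> ?M i" if "i < d" for i
  proof -
    have "real (l i) \<le> real (l' i + w' i)" "real (l' i) \<le> real (l i + w i)"
      using x that unfolding e(1) e'(1) grid_cell_def by (auto intro: order_trans)
    then show ?thesis by linarith
  qed
  have "e \<inter> e' = grid_cell N d ?m (\<lambda>i. ?M i - ?m i)"
  proof -
    have "real (?m i) \<le> r \<and> r \<le> real (?m i + (?M i - ?m i)) \<longleftrightarrow>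
        (real (l i) \<le> r \<and> r \<le> real (l i + w i)) \<and> (real (l' i) \<le> r \<and> r \<le> real (l' i + w' i))"
      if "i < d" for i r
      using le[OF that] by (auto simp: of_nat_max of_nat_min)
    then show ?thesis unfolding e(1) e'(1) grid_cell_def by auto
  qed
  moreover have "?M i - ?m i \<le> 1" "?m i + (?M i - ?m i) \<le> N" if "i < d" for i
    using le[OF that] e(2,3)[OF that] e'(2,3)[OF that] by auto
  ultimately show ?thesis by (simp add: gridI)
qed

lemma grid_cell_subset_cube:
  assumes "N \<ge> 1" "e \<in> grid N d"
  shows "e \<subseteq> unit_cube d"
proof
  fix x assume x: "x \<in> e"
  obtain l w where e: "e = grid_cell N d l w" "\<And>i. i < d \<Longrightarrow> l i + w i \<le> N"
    using gridE[OF assms(2)] by metis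
  have "0 \<le> x i \<and> x i \<le> 1" if "i < d" for i
  proof -
    have "0 \<le> real N * x i" "real N * x i \<le> real N * 1"
      using x e(2)[OF that] that unfolding e(1) grid_cell_def by force+
    then show ?thesis using assms(1) by (simp add: zero_le_mult_iff)
  qed
  then show "x \<in> unit_cube d" using x unfolding e(1) grid_cell_def unit_cube_def by blast
qed

lemma grid_coordinate:
  assumes "N \<ge> 1" "0 \<le> (r::real)" "r \<le> 1"
  obtains k where "k + 1 \<le> N" "real k \<le> real N * r" "real N * r \<le> real (k + 1)"
proof (cases "r = 1")
  case True
  \<comment> \<open>At the right end the floor would give the index \<open>N\<close>, one too many;
    the last interval is taken instead.\<close>
  then show ?thesis using that[of "N - 1"] assms(1) by simp
next
  case False
  then have Nr: "0 \<le> real N * r" "real N * r < real N" using assms by auto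
  let ?k = "nat \<lfloor>real N * r\<rfloor>"
  have k: "real ?k \<le> real N * r" "real N * r \<le> real (?k + 1)"
    using Nr by linarith+
  then have "?k + 1 \<le> N" using Nr by linarith
  then show ?thesis using that k by blast
qed

lemma cover_by_grid:
  assumes "N \<ge> 1" "x \<in> unit_cube d"
  obtains l where "\<And>i. i < d \<Longrightarrow> l i + 1 \<le> N" "x \<in> grid_cell N d l (\<lambda>_. 1)"
proof -
  have "\<exists>k. i < d \<longrightarrow> k + 1 \<le> N \<and> real k \<le> real N * x i \<and> real N * x i \<le> real (k + 1)" for i
    using grid_coordinate[OF assms(1), of "x i"] assms(2) unfolding unit_cube_def by blast
  then obtain l where "\<And>i. i < d \<Longrightarrow> l i + 1 \<le> N \<and> real (l i) \<le> real N * x i \<and> real N * x i \<le> real (l i + 1)"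
    by metis
  then show ?thesis using that[of l] assms(2) unfolding grid_cell_def unit_cube_def by auto
qed

lemma Union_grid:
  assumes "N \<ge> 1"
  shows "\<Union>(grid N d) = unit_cube d"
proof
  show "\<Union>(grid N d) \<subseteq> unit_cube d" using grid_cell_subset_cube[OF assms] by blast
  show "unit_cube d \<subseteq> \<Union>(grid N d)"
  proof
    fix x assume "x \<in> unit_cube d"
    then obtain l where "\<And>i. i < d \<Longrightarrow> l i + 1 \<le> N" "x \<in> grid_cell N d l (\<lambda>_. 1)"
      using cover_by_grid[OF assms] by metis
    then show "x \<in> \<Union>(grid N d)" using gridI[of d "\<lambda>_. 1" l N] by auto
  qed
qed

lemma Union_grid_boundary:
  assumes "N \<ge> 1"
  shows "\<Union>{e \<in> grid N d. e \<subseteq> cube_boundary d} = cube_boundary d"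
proof
  show "cube_boundary d \<subseteq> \<Union>{e \<in> grid N d. e \<subseteq> cube_boundary d}"
  proof
    fix x assume x: "x \<in> cube_boundary d"
    then obtain k where k: "k < d" "x k = 0 \<or> x k = 1" "x \<in> unit_cube d"
      unfolding cube_boundary_def by blast
    obtain l where l: "\<And>i. i < d \<Longrightarrow> l i + 1 \<le> N" "x \<in> grid_cell N d l (\<lambda>_. 1)"
      using cover_by_grid[OF assms k(3)] by metis
    \<comment> \<open>The cell is flattened in direction \<open>k\<close> onto the face of the cube
      that contains \<open>x\<close>, so that it lies inside the boundary.\<close>
    define l' where "l' = l(k := if x k = 0 then 0 else N)"
    define w' where "w' = (\<lambda>i. if i = k then 0 else 1::nat)"
    have g: "grid_cell N d l' w' \<in> grid N d"
    proof (rule gridI)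
      show "l' i + w' i \<le> N" if "i < d" for i using l(1)[OF that] by (auto simp: l'_def w'_def)
    qed (auto simp: w'_def)
    have "x \<in> grid_cell N d l' w'"
      using l(2) k unfolding grid_cell_def l'_def w'_def by auto
    moreover have "grid_cell N d l' w' \<subseteq> cube_boundary d"
    proof
      fix y assume y: "y \<in> grid_cell N d l' w'"
      have "y \<in> unit_cube d" using y grid_cell_subset_cube[OF assms g] by blast
      moreover have "real N * y k = real (l' k)"
        using y k(1) unfolding grid_cell_def w'_def by force
      then have "y k = 0 \<or> y k = 1" using assms by (auto simp: l'_def split: if_splits)
      ultimately show "y \<in> cube_boundary d" using k(1) unfolding cube_boundary_def by blast
    qed
    ultimately show "x \<in> \<Union>{e \<in> grid N d. e \<subseteq> cube_boundary d}" using g by blast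
  qed
qed blast

lemma grid_cell_corners:
  assumes "N \<ge> 1" "\<And>i. i < d \<Longrightarrow> c i \<le> w i"
  shows "(\<lambda>i. if i < d then real (l i + c i) / real N else 0) \<in> grid_cell N d l w"
  using assms unfolding grid_cell_def coord_space_def by auto

lemma Union_proper_cells:
  assumes "N \<ge> 1" and w: "\<And>i. i < d \<Longrightarrow> w i \<le> 1" and lw: "\<And>i. i < d \<Longrightarrow> l i + w i \<le> N"
  shows "\<Union>{e \<in> grid N d. e \<subset> grid_cell N d l w} = cell_boundary N d l w"
proof
  show "cell_boundary N d l w \<subseteq> \<Union>{e \<in> grid N d. e \<subset> grid_cell N d l w}"
  proof
    fix x assume "x \<in> cell_boundary N d l w"
    then obtain k where x: "x \<in> grid_cell N d l w" "k < d" "w k = 1"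
      and k: "real N * x k = real (l k) \<or> real N * x k = real (l k + 1)"
      unfolding cell_boundary_def by blast
    \<comment> \<open>\<open>c\<close> selects the end of the interval in the free direction
      \<open>k\<close> at which \<open>x\<close> sits; setting the width there to 0 gives the face
      through \<open>x\<close>.\<close>
    define c where "c = (if real N * x k = real (l k) then 0 else 1::nat)"
    have xk: "real N * x k = real (l k + c)" using k by (auto simp: c_def)
    let ?e = "grid_cell N d (l(k := l k + c)) (w(k := 0))"
    have "x \<in> ?e" using x xk unfolding grid_cell_def by auto
    moreover have "?e \<in> grid N d"
      using w lw lw[OF x(2)] x(3) by (intro gridI) (auto simp: c_def)
    moreover have "?e \<subseteq> grid_cell N d l w"
    proof
      fix y assume y: "y \<in> ?e"
      have "real N * y k = real (l k + c)"
        using y x(2) unfolding grid_cell_def by force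
      then have "real (l k) \<le> real N * y k \<and> real N * y k \<le> real (l k + w k)"
        using x(3) by (auto simp: c_def)
      moreover have "real (l i) \<le> real N * y i \<and> real N * y i \<le> real (l i + w i)" if "i < d" "i \<noteq> k" for i
        using y that unfolding grid_cell_def by force
      ultimately show "y \<in> grid_cell N d l w" using y unfolding grid_cell_def by blast
    qed
    \<comment> \<open>A corner at the opposite end in direction \<open>k\<close> lies in the cell
      but not in the face, so the inclusion is proper.\<close>
    moreover have "(\<lambda>i. if i < d then real (l i + (if i = k then 1 - c else 0)) / real N else 0) \<notin> ?e"
      using x(2) assms(1) unfolding grid_cell_def by (auto simp: c_def intro!: exI[of _ k])
    moreover have "(\<lambda>i. if i < d then real (l i + (if i = k then 1 - c else 0)) / real N else 0) \<in> grid_cell N d l w"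
      by (rule grid_cell_corners[OF assms(1)]) (use x(3) in auto)
    ultimately show "x \<in> \<Union>{e \<in> grid N d. e \<subset> grid_cell N d l w}" by blast
  qed
  show "\<Union>{e \<in> grid N d. e \<subset> grid_cell N d l w} \<subseteq> cell_boundary N d l w"
  proof
    fix x assume "x \<in> \<Union>{e \<in> grid N d. e \<subset> grid_cell N d l w}"
    then obtain e where x: "x \<in> e" and e: "e \<in> grid N d" "e \<subset> grid_cell N d l w"
      by blast
    show "x \<in> cell_boundary N d l w"
    proof (rule ccontr)
      assume nb: "x \<notin> cell_boundary N d l w"
      have xg: "x \<in> grid_cell N d l w" using x e by blast
      obtain l' w' where e': "e = grid_cell N d l' w'" using gridE[OF e(1)] by metis
      \<comment> \<open>Off the boundary, \<open>N * x i\<close> lies strictly between consecutive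
        integers in every free direction. Any integer interval containing it then contains the whole
        unit interval, so a grid cell through \<open>x\<close> contains the given cell and cannot be
        proper in it.\<close>
      have "l' i \<le> l i \<and> l i + w i \<le> l' i + w' i" if i: "i < d" for i
      proof -
        have 1: "real (l' i) \<le> real N * x i" "real N * x i \<le> real (l' i + w' i)"
          using x i unfolding e' grid_cell_def by auto
        have 2: "real (l i) \<le> real N * x i" "real N * x i \<le> real (l i + w i)"
          using xg i unfolding grid_cell_def by auto
        show ?thesis
        proof (cases "w i = 1")
          case True
          then have "real N * x i \<noteq> real (l i)" "real N * x i \<noteq> real (l i + 1)"
            using nb xg i unfolding cell_boundary_def by auto
          then show ?thesis using 1 2 True by linarith
        next
          case False
          then have "w i = 0" using w[OF i] by simp
          then show ?thesis using 1 2 by linarith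
        qed
      qed
      then have "grid_cell N d l w \<subseteq> e"
        unfolding e' grid_cell_def by (fastforce intro: order_trans simp flip: of_nat_add)
      then show False using e(2) by blast
    qed
  qed
qed

lemma sup_gauge_le_iff: "sup_gauge j x \<le> 1 \<longleftrightarrow> (\<forall>i<j. \<bar>x i\<bar> \<le> 1)"
  unfolding sup_gauge_def by auto

lemma sup_gauge_eq_iff: "sup_gauge j x = 1 \<longleftrightarrow> (\<forall>i<j. \<bar>x i\<bar> \<le> 1) \<and> (\<exists>i<j. \<bar>x i\<bar> = 1)"
proof -
  have "sup_gauge j x = 1 \<longleftrightarrow> sup_gauge j x \<le> 1 \<and> 1 \<le> sup_gauge j x" by auto
  also have "1 \<le> sup_gauge j x \<longleftrightarrow> (\<exists>i<j. 1 \<le> \<bar>x i\<bar>)"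
    unfolding sup_gauge_def by (subst Max_ge_iff) auto
  finally show ?thesis unfolding sup_gauge_le_iff by (metis order_antisym order_refl)
qed

text \<open>The cell is a cube in its free directions, which \<open>\<beta>\<close> enumerates. The
  chart \<open>\<psi>\<close> rescales the interval from \<open>l/N\<close> to
  \<open>(l+1)/N\<close> to the one from -1 to 1 in each of them; \<open>\<phi>\<close> reinstates
  the fixed coordinates.\<close>

lemma filling_grid_cell:
  assumes "N \<ge> 1" and w: "\<And>i. i < d \<Longrightarrow> w i \<le> 1" and "fillable (card {i. i < d \<and> w i = 1}) X"
  shows "filling (grid_cell N d l w) (cell_boundary N d l w) X"
proof -
  let ?J = "{i. i < d \<and> w i = 1}" and ?j = "card {i. i < d \<and> w i = 1}"
  have "finite ?J" by simp
  then obtain \<beta> where \<beta>: "bij_betw \<beta> {..<?j} ?J"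
    using bij_betw_from_nat_into_finite by blast
  let ?\<gamma> = "the_inv_into {..<?j} \<beta>"
  have \<beta>J: "\<beta> k < d" "w (\<beta> k) = 1" if "k < ?j" for k
    using bij_betwE[OF \<beta>] that by auto
  have \<gamma>\<beta>: "?\<gamma> (\<beta> k) = k" if "k < ?j" for k
    using that \<beta> by (simp add: bij_betw_imp_inj_on the_inv_into_f_f)
  have \<gamma>J: "?\<gamma> i < ?j" "\<beta> (?\<gamma> i) = i" if "i < d" "w i = 1" for i
    using that bij_betwE[OF bij_betw_the_inv_into[OF \<beta>]] f_the_inv_into_f_bij_betw[OF \<beta>, of i] by auto
  define \<psi> :: "(nat \<Rightarrow> real) \<Rightarrow> nat \<Rightarrow> real"
    where "\<psi> = (\<lambda>x k. if k < ?j then 2 * (real N * x (\<beta> k) - real (l (\<beta> k))) - 1 else 0)"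
  define \<phi> :: "(nat \<Rightarrow> real) \<Rightarrow> nat \<Rightarrow> real"
    where "\<phi> = (\<lambda>y i. if i < d then (real (l i) + (if w i = 1 then (y (?\<gamma> i) + 1) / 2 else 0)) / real N else 0)"
  have N\<phi>: "real N * \<phi> y i = real (l i) + (if w i = 1 then (y (?\<gamma> i) + 1) / 2 else 0)" if "i < d" for y i
    using that assms(1) by (simp add: \<phi>_def)
  have w0: "w i = 0" if "i < d" "w i \<noteq> 1" for i using w[OF that(1)] that(2) by simp
  show ?thesis
  proof (rule filling_transfer[OF assms(3)[folded filling_cube_iff]])
    show "continuous_on (grid_cell N d l w) \<psi>" unfolding \<psi>_def
    proof (rule continuous_on_coordinatewise_then_product)
      show "continuous_on (grid_cell N d l w) (\<lambda>x. if k < ?j then 2 * (real N * x (\<beta> k) - real (l (\<beta> k))) - 1 else 0)" for k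
        by (cases "k < ?j") (simp_all add: continuous_intros)
    qed
    have b: "\<bar>\<psi> x k\<bar> \<le> 1" if x: "x \<in> grid_cell N d l w" and k: "k < ?j" for x k
    proof -
      have "real (l (\<beta> k)) \<le> real N * x (\<beta> k)" "real N * x (\<beta> k) \<le> real (l (\<beta> k) + 1)"
        using x \<beta>J[OF k] unfolding grid_cell_def by force+
      then show ?thesis using k by (simp add: \<psi>_def)
    qed
    have c: "\<psi> x \<in> coord_space ?j" for x by (simp add: \<psi>_def coord_space_def)
    show "\<psi> ` grid_cell N d l w \<subseteq> gauge_ball ?j (sup_gauge ?j)"
      using b c by (auto simp: gauge_ball_def sup_gauge_le_iff)
    show "\<psi> ` cell_boundary N d l w \<subseteq> gauge_sphere ?j (sup_gauge ?j)"
    proof (rule image_subsetI)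
      fix x assume x: "x \<in> cell_boundary N d l w"
      then obtain i where i: "i < d" "w i = 1" "real N * x i = real (l i) \<or> real N * x i = real (l i + 1)"
        unfolding cell_boundary_def by blast
      then have "\<bar>\<psi> x (?\<gamma> i)\<bar> = 1" using \<gamma>J[OF i(1,2)] by (auto simp: \<psi>_def)
      then show "\<psi> x \<in> gauge_sphere ?j (sup_gauge ?j)"
        using \<gamma>J[OF i(1,2)] b c x unfolding gauge_sphere_def sup_gauge_eq_iff cell_boundary_def by blast
    qed
    show "continuous_on (gauge_sphere ?j (sup_gauge ?j)) \<phi>" unfolding \<phi>_def
    proof (rule continuous_on_coordinatewise_then_product)
      show "continuous_on (gauge_sphere ?j (sup_gauge ?j))
         (\<lambda>y. if i < d then (real (l i) + (if w i = 1 then (y (?\<gamma> i) + 1) / 2 else 0)) / real N else 0)" for i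
        by (cases "i < d"; cases "w i = 1") (use assms(1) in \<open>simp_all add: continuous_intros\<close>)
    qed
    show "\<phi> ` gauge_sphere ?j (sup_gauge ?j) \<subseteq> cell_boundary N d l w"
    proof (rule image_subsetI)
      fix y assume y: "y \<in> gauge_sphere ?j (sup_gauge ?j)"
      then have y1: "\<bar>y k\<bar> \<le> 1" if "k < ?j" for k using that by (auto simp: gauge_sphere_def sup_gauge_eq_iff)
      obtain k where k: "k < ?j" "\<bar>y k\<bar> = 1" using y by (auto simp: gauge_sphere_def sup_gauge_eq_iff)
      have "real (l i) \<le> real N * \<phi> y i \<and> real N * \<phi> y i \<le> real (l i + w i)" if "i < d" for i
        using N\<phi>[OF that, of y] y1[OF \<gamma>J(1)[OF that]] w0[OF that] by (cases "w i = 1") auto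
      then have "\<phi> y \<in> grid_cell N d l w" by (simp add: grid_cell_def coord_space_def \<phi>_def)
      moreover have "real N * \<phi> y (\<beta> k) = real (l (\<beta> k)) + (y k + 1) / 2"
        using N\<phi>[of "\<beta> k" y] \<beta>J[OF k(1)] \<gamma>\<beta>[OF k(1)] by simp
      then have "real N * \<phi> y (\<beta> k) = real (l (\<beta> k)) \<or> real N * \<phi> y (\<beta> k) = real (l (\<beta> k) + 1)"
        using k(2) by (auto simp: abs_if split: if_splits)
      ultimately show "\<phi> y \<in> cell_boundary N d l w"
        using \<beta>J[OF k(1)] unfolding cell_boundary_def by blast
    qed
    show "\<phi> (\<psi> x) = x" if "x \<in> cell_boundary N d l w" for x
    proof
      fix i
      have x: "x \<in> grid_cell N d l w" using that by (simp add: cell_boundary_def)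
      show "\<phi> (\<psi> x) i = x i"
      proof (cases "i < d")
        case False
        then show ?thesis using x by (simp add: \<phi>_def grid_cell_def coord_space_def)
      next
        case True
        have "real N * \<phi> (\<psi> x) i = real N * x i"
        proof (cases "w i = 1")
          case w1: True
          have "\<psi> x (?\<gamma> i) = 2 * (real N * x i - real (l i)) - 1"
            using \<gamma>J[OF True w1] by (simp add: \<psi>_def)
          then show ?thesis using N\<phi>[OF True, of "\<psi> x"] w1 by (simp add: field_simps)
        next
          case False
          then have "real N * x i = real (l i)"
            using x w0[OF True False] True unfolding grid_cell_def by force
          then show ?thesis using N\<phi>[OF True] False by simp
        qed
        then show ?thesis using assms(1) by simp
      qed
    qed
  qed
qed


text \<open>A cell properly contained in another one has dimension below \<open>d\<close>. Degree
  \<open>d\<close> is therefore demanded for maximal cells only, which is what permits the weaker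
  assumption on an intersection in \<open>fillable_Un\<close>.\<close>

lemma filling_grid:
  assumes "N \<ge> 1" "e \<in> grid N d"
    and "\<And>j. j \<le> d \<Longrightarrow> (j < d \<or> \<not> (\<exists>e'\<in>grid N d. e \<subset> e')) \<Longrightarrow> fillable j X"
  shows "filling e (\<Union>{e' \<in> grid N d. e' \<subset> e}) X"
proof -
  obtain l w where e: "e = grid_cell N d l w"
    and w: "\<And>i. i < d \<Longrightarrow> w i \<le> 1" and lw: "\<And>i. i < d \<Longrightarrow> l i + w i \<le> N"
    using gridE[OF assms(2)] by metis
  let ?J = "{i. i < d \<and> w i = 1}"
  have J: "card ?J \<le> d" using card_mono[of "{..<d}" ?J] by auto
  have "card ?J < d \<or> \<not> (\<exists>e'\<in>grid N d. e \<subset> e')"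
  proof (rule disjCI)
    assume "\<not> \<not> (\<exists>e'\<in>grid N d. e \<subset> e')"
    then obtain e' where e': "e' \<in> grid N d" "e \<subset> e'" by blast
    obtain l' w' where lw': "e' = grid_cell N d l' w'" "\<And>i. i < d \<Longrightarrow> w' i \<le> 1"
      using gridE[OF e'(1)] by metis
    have "?J \<noteq> {..<d}"
    proof
      assume "?J = {..<d}"
      then have w1: "w i = 1" if "i < d" for i using that by blast
      \<comment> \<open>A full-dimensional \<open>e\<close> has corners at both ends of each
        direction. As they lie in \<open>e'\<close>, whose widths are at most 1, the cells
        \<open>e\<close> and \<open>e'\<close> coincide.\<close>
      have in_e': "real (l' i) \<le> real (l i + c) \<and> real (l i + c) \<le> real (l' i + w' i)"
        if "i < d" "c \<le> 1" for i c
      proof -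
        have "(\<lambda>i. if i < d then real (l i + c) / real N else 0) \<in> e"
          unfolding e by (rule grid_cell_corners[OF assms(1)]) (use w1 that in auto)
        then have "(\<lambda>i. if i < d then real (l i + c) / real N else 0) \<in> grid_cell N d l' w'"
          using e'(2) lw'(1) by blast
        then show ?thesis using that(1) assms(1) unfolding grid_cell_def by force
      qed
      have "l' i = l i \<and> w' i = w i" if "i < d" for i
        using in_e'[OF that, of 0] in_e'[OF that, of 1] lw'(2)[OF that] w1[OF that] by simp
      then have "e = e'" unfolding e lw'(1) by (intro grid_cell_cong) simp_all
      then show False using e'(2) by blast
    qed
    then have "?J \<subset> {..<d}" by blast
    from psubset_card_mono[OF _ this] show "card ?J < d" by simp
  qed
  from assms(3)[OF J this] have "filling (grid_cell N d l w) (cell_boundary N d l w) X"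
    by (intro filling_grid_cell assms(1) w)
  moreover have "\<Union>{e' \<in> grid N d. e' \<subset> grid_cell N d l w} = cell_boundary N d l w"
    by (intro Union_proper_cells assms(1) w lw)
  ultimately show ?thesis unfolding e by simp
qed

lemma fillable_of_filling_cube:
  assumes "filling (unit_cube d) (cube_boundary d) X"
  shows "fillable d X"
proof -
  let ?\<psi> = "\<lambda>x i. if i < d then (x i + 1) / 2 else (0::real)"
  let ?\<phi> = "\<lambda>x i. if i < d then 2 * x i - 1 else (0::real)"
  have cont: "continuous_on S (\<lambda>x i. if i < d then g (x i) else (0::real))"
    if "continuous_on UNIV g" for g :: "real \<Rightarrow> real" and S
  proof (rule continuous_on_coordinatewise_then_product)
    show "continuous_on S (\<lambda>x. if i < d then g (x i) else 0)" for i
      by (cases "i < d") (auto intro!: continuous_on_compose2[OF that] continuous_intros)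
  qed
  show ?thesis unfolding filling_cube_iff[symmetric]
  proof (rule filling_transfer[OF assms])
    show "continuous_on (gauge_ball d (sup_gauge d)) ?\<psi>"
      by (rule cont) (intro continuous_intros, simp)
    show "continuous_on (cube_boundary d) ?\<phi>"
      by (rule cont) (intro continuous_intros)
    show "?\<psi> ` gauge_ball d (sup_gauge d) \<subseteq> unit_cube d"
      by (auto simp: gauge_ball_def unit_cube_def coord_space_def sup_gauge_le_iff abs_le_iff)
    show "?\<psi> ` gauge_sphere d (sup_gauge d) \<subseteq> cube_boundary d"
      by (auto simp: gauge_sphere_def cube_boundary_def unit_cube_def coord_space_def sup_gauge_eq_iff abs_le_iff
          abs_if split: if_splits)
    show "?\<phi> ` cube_boundary d \<subseteq> gauge_sphere d (sup_gauge d)"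
      by (auto simp: gauge_sphere_def cube_boundary_def unit_cube_def coord_space_def sup_gauge_eq_iff abs_le_iff
          split: if_splits)
    show "?\<phi> (?\<psi> x) = x" if "x \<in> gauge_sphere d (sup_gauge d)" for x
      using that by (auto simp: gauge_sphere_def coord_space_def fun_eq_iff field_simps)
  qed
qed

section \<open>Fine subdivisions and unions of two open sets\<close>

lemma compact_cube_boundary: "compact (cube_boundary d)"
proof -
  have "unit_cube d = (\<Pi>\<^sub>E i\<in>UNIV. if i < d then {0..1} else {0})"
    by (auto simp: unit_cube_def coord_space_def PiE_iff split: if_splits)
  moreover have "compactin (product_topology (\<lambda>i. euclideanreal) UNIV) (\<Pi>\<^sub>E i\<in>UNIV. if i < d then {0..1} else {0})"
    unfolding compactin_PiE by auto
  ultimately have "compact (unit_cube d)"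
    by (simp add: euclidean_product_topology)
  moreover have "cube_boundary d = unit_cube d \<inter> (\<Union>i\<in>{..<d}. {x. x i = 0} \<union> {x. x i = 1})"
    by (auto simp: cube_boundary_def)
  moreover have "closed (\<Union>i\<in>{..<d}. {x. x i = (0::real)} \<union> {x. x i = 1})"
    by (intro closed_UN ballI closed_Un closed_Collect_eq continuous_intros) simp
  ultimately show ?thesis by (simp add: compact_Int_closed)
qed

text \<open>The metric on sequences is a sum of coordinate distances, cut off at 1 and weighted by
  \<open>(1/2)^n\<close>; the weights add up to 2.\<close>

lemma dist_fun_le:
  fixes x y :: "nat \<Rightarrow> real"
  assumes "0 \<le> r" "\<And>i. \<bar>x i - y i\<bar> \<le> r"
  shows "dist x y \<le> 2 * r"
proof -
  have s: "summable (\<lambda>n. (1/2)^n * min (dist (x (from_nat n)) (y (from_nat n))) 1)"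
    by (rule summable_comparison_test'[of "\<lambda>n. (1/2)^n"]) (auto simp: summable_geometric_iff)
  have "dist x y \<le> suminf (\<lambda>n. (1/2)^n * r)"
    unfolding dist_fun_def
    by (rule suminf_le[OF _ s]) (use assms in \<open>auto intro!: mult_left_mono summable_mult2 simp: dist_real_def min.coboundedI1\<close>)
  also have "\<dots> = 2 * r"
    using suminf_geometric[of "1/2 :: real"] by (simp add: suminf_mult2[symmetric])
  finally show ?thesis .
qed

text \<open>A Lebesgue number for the cover of the compact boundary by the preimages of
  \<open>U\<close> and \<open>V\<close>. Only \<open>e \<inter> cube_boundary d\<close> is
  controlled, since \<open>f\<close> is given on the boundary alone.\<close>

lemma fine_grid:
  fixes f :: "(nat \<Rightarrow> real) \<Rightarrow> 'b::topological_space"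
  assumes "continuous_on (cube_boundary d) f" "f ` cube_boundary d \<subseteq> U \<union> V"
    and "openin (top_of_set (U \<union> V)) U" "openin (top_of_set (U \<union> V)) V"
  obtains N where "N \<ge> 1"
    "\<And>e. e \<in> grid N d \<Longrightarrow> f ` (e \<inter> cube_boundary d) \<subseteq> U \<or> f ` (e \<inter> cube_boundary d) \<subseteq> V"
proof -
  let ?C = "cube_boundary d"
  have f: "f \<in> ?C \<rightarrow> U \<union> V" using assms(2) by blast
  obtain U' where U': "open U'" "?C \<inter> f -` U = ?C \<inter> U'"
    using continuous_openin_preimage[OF assms(1) f assms(3)] unfolding openin_open by (elim exE conjE)
  obtain V' where V': "open V'" "?C \<inter> f -` V = ?C \<inter> V'"
    using continuous_openin_preimage[OF assms(1) f assms(4)] unfolding openin_open by (elim exE conjE)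
  have "?C \<subseteq> \<Union>{U', V'}"
  proof
    fix x assume x: "x \<in> ?C"
    then have "f x \<in> U \<or> f x \<in> V" using f by blast
    then have "x \<in> ?C \<inter> f -` U \<or> x \<in> ?C \<inter> f -` V" using x by simp
    then show "x \<in> \<Union>{U', V'}" unfolding U'(2) V'(2) by auto
  qed
  then obtain \<delta> where \<delta>: "0 < \<delta>" "\<And>T. T \<subseteq> ?C \<Longrightarrow> diameter T < \<delta> \<Longrightarrow> \<exists>B\<in>{U', V'}. T \<subseteq> B"
    using Lebesgue_number_lemma[OF compact_cube_boundary, of "{U', V'}" d] U'(1) V'(1) by auto
  \<comment> \<open>Coordinates vary by at most \<open>1/N\<close> within a cell, so its diameter is
    at most \<open>2/N\<close> by \<open>dist_fun_le\<close>.\<close>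
  obtain N :: nat where N: "2 / \<delta> < real N" using reals_Archimedean2 by blast
  then have N1: "N \<ge> 1" using \<delta>(1) by (cases N) (auto simp: divide_less_0_iff)
  have "f ` (e \<inter> ?C) \<subseteq> U \<or> f ` (e \<inter> ?C) \<subseteq> V" if eg: "e \<in> grid N d" for e
  proof -
    obtain l w where e: "e = grid_cell N d l w" "\<And>i. i < d \<Longrightarrow> w i \<le> 1"
      using gridE[OF eg] by metis
    have "dist x y \<le> 2 / real N" if "x \<in> e" "y \<in> e" for x y
    proof -
      have "\<bar>x i - y i\<bar> \<le> 1 / real N" for i
      proof (cases "i < d")
        case True
        then have "\<bar>real N * x i - real N * y i\<bar> \<le> 1"
          using that e(2)[OF True] unfolding e(1) grid_cell_def by force
        then have "real N * \<bar>x i - y i\<bar> \<le> 1" by (simp add: abs_mult right_diff_distrib[symmetric])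
        then show ?thesis using N1 by (simp add: field_simps)
      next
        case False
        then show ?thesis using that unfolding e(1) grid_cell_def coord_space_def by simp
      qed
      then show ?thesis using dist_fun_le[of "1 / real N" x y] by simp
    qed
    then have "diameter (e \<inter> ?C) \<le> 2 / real N"
      unfolding diameter_def by (auto intro!: cSUP_least)
    also have "2 / real N < \<delta>" using N N1 \<delta>(1) by (simp add: field_simps)
    finally have "e \<inter> ?C \<subseteq> U' \<or> e \<inter> ?C \<subseteq> V'" using \<delta>(2)[of "e \<inter> ?C"] by blast
    then have "e \<inter> ?C \<subseteq> ?C \<inter> f -` U \<or> e \<inter> ?C \<subseteq> ?C \<inter> f -` V" unfolding U'(2) V'(2) by simp
    then show ?thesis by auto
  qed
  with N1 show ?thesis by (rule that)
qed

lemma fillable_Un: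
  fixes U V :: "'b::topological_space set"
  assumes U: "openin (top_of_set (U \<union> V)) U" "\<And>j. j \<le> d \<Longrightarrow> fillable j U"
    and V: "openin (top_of_set (U \<union> V)) V" "\<And>j. j \<le> d \<Longrightarrow> fillable j V"
    and UV: "\<And>j. j < d \<Longrightarrow> fillable j (U \<inter> V)"
  shows "fillable d (U \<union> V)"
proof (rule fillable_of_filling_cube, unfold filling_def, intro allI impI, elim conjE)
  let ?C = "cube_boundary d"
  fix f assume f: "continuous_on ?C f" "f ` ?C \<subseteq> U \<union> V"
  obtain N where N: "N \<ge> 1"
    and fine: "\<And>e. e \<in> grid N d \<Longrightarrow> f ` (e \<inter> ?C) \<subseteq> U \<or> f ` (e \<inter> ?C) \<subseteq> V"
    using fine_grid[OF f U(1) V(1)] by metis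
  let ?G = "grid N d" and ?A = "{e \<in> grid N d. e \<subseteq> ?C}"
  \<comment> \<open>Non-maximal cells are sent to \<open>U \<inter> V\<close> whenever the
    prescribed values allow it, in particular when they miss the boundary. Maximal cells never are:
    they may need degree \<open>d\<close>, which is available only in \<open>U\<close> and in
    \<open>V\<close>.\<close>
  define small where "small e \<longleftrightarrow> (\<exists>e'\<in>?G. e \<subset> e')" for e
  define T where "T e = (if small e \<and> f ` (e \<inter> ?C) \<subseteq> U \<inter> V then U \<inter> V
    else if f ` (e \<inter> ?C) \<subseteq> U then U else V)" for e
  have "\<exists>g. continuous_on (\<Union>?G) g \<and> (\<forall>x\<in>\<Union>?A. g x = f x) \<and> (\<forall>e\<in>?G. g ` e \<subseteq> T e)"
  proof (rule cell_extension[OF finite_grid])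
    show "closed e" if "e \<in> ?G" for e using that gridE closed_grid_cell by metis
    show "e \<inter> e' \<in> ?G" if "e \<in> ?G" "e' \<in> ?G" "e \<inter> e' \<noteq> {}" for e e' using grid_Int that by blast
    show "filling e (\<Union>{e' \<in> ?G. e' \<subset> e}) (T e)" if e: "e \<in> ?G" for e
    proof (rule filling_grid[OF N e])
      fix j assume j: "j \<le> d" "j < d \<or> \<not> (\<exists>e'\<in>?G. e \<subset> e')"
      then show "fillable j (T e)"
        using U(2) V(2) UV unfolding T_def small_def by auto
    qed
    \<comment> \<open>If the values on \<open>e\<close> leave \<open>U \<inter> V\<close>, they
      single out one of the two sets, and the values on the larger \<open>e'\<close> single out the
      same one. Otherwise \<open>T e\<close> is \<open>U \<inter> V\<close>, since \<open>e\<close>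
      is not maximal.\<close>
    show "T e \<subseteq> T e'" if e: "e \<in> ?G" "e' \<in> ?G" "e \<subset> e'" for e e'
    proof -
      have "small e" using e unfolding small_def by blast
      moreover have "(if P \<subseteq> U \<inter> V then U \<inter> V else if P \<subseteq> U then U else V) \<subseteq>
          (if small e' \<and> P' \<subseteq> U \<inter> V then U \<inter> V else if P' \<subseteq> U then U else V)"
        if "P \<subseteq> P'" "P' \<subseteq> U \<or> P' \<subseteq> V" for P P'
        using that by (cases "P \<subseteq> U"; cases "P \<subseteq> V") auto
      moreover have "f ` (e \<inter> ?C) \<subseteq> f ` (e' \<inter> ?C)" using e(3) by blast
      ultimately show ?thesis using fine[OF e(2)] unfolding T_def by presburger
    qed
    show "continuous_on (\<Union>?A) f" using f(1) Union_grid_boundary[OF N] by simp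
    show "f ` e \<subseteq> T e" if "e \<in> ?A" for e
    proof -
      have "e \<inter> ?C = e" using that by blast
      then show ?thesis using fine[of e] that unfolding T_def by auto
    qed
  qed auto
  then obtain g where g: "continuous_on (\<Union>?G) g" "\<forall>x\<in>\<Union>?A. g x = f x" "\<forall>e\<in>?G. g ` e \<subseteq> T e"
    by (elim exE conjE)
  have "g ` (\<Union>?G) \<subseteq> U \<union> V"
  proof (rule image_subsetI)
    fix x assume "x \<in> \<Union>?G"
    then obtain e where "e \<in> ?G" "x \<in> e" by blast
    then have "g x \<in> T e" using g(3) by blast
    then show "g x \<in> U \<union> V" unfolding T_def by (auto split: if_splits)
  qed
  then show "\<exists>g. continuous_on (unit_cube d) g \<and> g ` unit_cube d \<subseteq> U \<union> V \<and> (\<forall>x\<in>?C. g x = f x)"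
    using g(1,2) unfolding Union_grid[OF N] Union_grid_boundary[OF N] by (intro exI[of _ g] conjI)
qed

section \<open>Simplices and their boundaries\<close>

definition std_simplex :: "'a set \<Rightarrow> ('a \<Rightarrow> real) set" where
  "std_simplex W = {x. (\<forall>v. 0 \<le> x v) \<and> (\<forall>v. v \<notin> W \<longrightarrow> x v = 0) \<and> sum x W = 1}"

definition simplex_boundary :: "'a set \<Rightarrow> ('a \<Rightarrow> real) set" where
  "simplex_boundary W = {x \<in> std_simplex W. \<exists>w\<in>W. x w = 0}"

definition vertex :: "'a \<Rightarrow> 'a \<Rightarrow> real" where
  "vertex s = (\<lambda>v. if v = s then 1 else 0)"

lemma simplex_gauge_le_iff: "simplex_gauge j y \<le> 1 \<longleftrightarrow> (\<Sum>k<j. y k) \<le> 1 \<and> (\<forall>k<j. - y k \<le> 1)"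
  unfolding simplex_gauge_def by auto

lemma simplex_gauge_eq_iff:
  "simplex_gauge j y = 1 \<longleftrightarrow> (\<Sum>k<j. y k) \<le> 1 \<and> (\<forall>k<j. - y k \<le> 1) \<and> ((\<Sum>k<j. y k) = 1 \<or> (\<exists>k<j. - y k = 1))"
proof -
  have "simplex_gauge j y = 1 \<longleftrightarrow> simplex_gauge j y \<le> 1 \<and> 1 \<le> simplex_gauge j y" by auto
  also have "1 \<le> simplex_gauge j y \<longleftrightarrow> 1 \<le> (\<Sum>k<j. y k) \<or> (\<exists>k<j. 1 \<le> - y k)"
    unfolding simplex_gauge_def by (subst Max_ge_iff) auto
  finally show ?thesis unfolding simplex_gauge_le_iff by (metis order_antisym order_refl)
qed

text \<open>One vertex \<open>w0\<close> is dropped and the other barycentric coordinates become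
  \<open>(j + 1) * x v - 1\<close>. This puts the barycentre at the origin; \<open>x v = 0\<close>
  turns into a coordinate equal to -1, and \<open>x w0 = 0\<close> into coordinate sum 1, the facets
  of \<open>simplex_gauge\<close>.\<close>

lemma simplex_chart:
  fixes W :: "'a set"
  assumes "finite W" "card W = Suc j"
  obtains \<psi> :: "('a \<Rightarrow> real) \<Rightarrow> nat \<Rightarrow> real" and \<phi> :: "(nat \<Rightarrow> real) \<Rightarrow> 'a \<Rightarrow> real"
  where "continuous_on (std_simplex W) \<psi>" "\<psi> ` std_simplex W \<subseteq> gauge_ball j (simplex_gauge j)"
    "\<psi> ` simplex_boundary W \<subseteq> gauge_sphere j (simplex_gauge j)"
    "continuous_on (gauge_sphere j (simplex_gauge j)) \<phi>"
    "\<phi> ` gauge_sphere j (simplex_gauge j) \<subseteq> simplex_boundary W"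
    "\<And>x. x \<in> simplex_boundary W \<Longrightarrow> \<phi> (\<psi> x) = x"
    "\<And>y. y \<in> gauge_sphere j (simplex_gauge j) \<Longrightarrow> \<psi> (\<phi> y) = y"
proof -
  obtain w0 where w0: "w0 \<in> W" using assms by fastforce
  let ?W = "W - {w0}"
  have fin: "finite ?W" and cardW: "card ?W = j" using assms w0 by auto
  obtain \<beta> where \<beta>: "bij_betw \<beta> {..<j} ?W"
    using bij_betw_from_nat_into_finite[OF fin] unfolding cardW by blast
  let ?\<gamma> = "the_inv_into {..<j} \<beta>" and ?c = "real j + 1"
  have \<beta>W: "\<beta> k \<in> W" "\<beta> k \<noteq> w0" if "k < j" for k
    using bij_betwE[OF \<beta>] that by auto
  have \<gamma>\<beta>: "?\<gamma> (\<beta> k) = k" if "k < j" for k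
    using that \<beta> by (simp add: bij_betw_imp_inj_on the_inv_into_f_f)
  have \<gamma>W: "?\<gamma> v < j" "\<beta> (?\<gamma> v) = v" if "v \<in> W" "v \<noteq> w0" for v
    using that bij_betwE[OF bij_betw_the_inv_into[OF \<beta>]] f_the_inv_into_f_bij_betw[OF \<beta>, of v] by auto
  have sumW: "sum f W = f w0 + (\<Sum>k<j. f (\<beta> k))" for f :: "'a \<Rightarrow> real"
    using sum.remove[OF assms(1) w0, of f] sum.reindex_bij_betw[OF \<beta>, of f] by simp
  define \<psi> :: "('a \<Rightarrow> real) \<Rightarrow> nat \<Rightarrow> real" where "\<psi> = (\<lambda>x k. if k < j then ?c * x (\<beta> k) - 1 else 0)"
  define \<phi> :: "(nat \<Rightarrow> real) \<Rightarrow> 'a \<Rightarrow> real"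
    where "\<phi> = (\<lambda>y v. if v = w0 then (1 - (\<Sum>k<j. y k)) / ?c else if v \<in> W then (y (?\<gamma> v) + 1) / ?c else 0)"
  have sum\<psi>: "(\<Sum>k<j. \<psi> x k) = 1 - ?c * x w0" if "x \<in> std_simplex W" for x
  proof -
    have "(\<Sum>k<j. \<psi> x k) = ?c * (\<Sum>k<j. x (\<beta> k)) - real j"
      by (simp add: \<psi>_def sum_subtractf sum_distrib_left)
    also have "(\<Sum>k<j. x (\<beta> k)) = 1 - x w0" using sumW[of x] that by (simp add: std_simplex_def)
    finally show ?thesis by (simp add: algebra_simps)
  qed
  have coord: "\<psi> x \<in> coord_space j" for x by (simp add: \<psi>_def coord_space_def)
  have \<psi>ge: "- \<psi> x k \<le> 1" if "x \<in> std_simplex W" "k < j" for x k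
    using that by (simp add: \<psi>_def std_simplex_def)
  have \<psi>le: "(\<Sum>k<j. \<psi> x k) \<le> 1" if "x \<in> std_simplex W" for x
    using that sum\<psi>[OF that] by (simp add: std_simplex_def)
  have \<phi>\<beta>: "\<phi> y (\<beta> k) = (y k + 1) / ?c" if "k < j" for y k
    using \<beta>W[OF that] \<gamma>\<beta>[OF that] by (simp add: \<phi>_def)
  have \<phi>w0: "\<phi> y w0 = (1 - (\<Sum>k<j. y k)) / ?c" for y by (simp add: \<phi>_def)
  show ?thesis
  proof (rule that)
    show "continuous_on (std_simplex W) \<psi>" unfolding \<psi>_def
    proof (rule continuous_on_coordinatewise_then_product)
      show "continuous_on (std_simplex W) (\<lambda>x. if k < j then ?c * x (\<beta> k) - 1 else 0)" for k
        by (cases "k < j") (simp_all add: continuous_intros)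
    qed
    show "\<psi> ` std_simplex W \<subseteq> gauge_ball j (simplex_gauge j)"
      using coord \<psi>ge \<psi>le by (auto simp: gauge_ball_def simplex_gauge_le_iff)
    show "\<psi> ` simplex_boundary W \<subseteq> gauge_sphere j (simplex_gauge j)"
    proof (rule image_subsetI)
      fix x assume "x \<in> simplex_boundary W"
      then obtain w where x: "x \<in> std_simplex W" "w \<in> W" "x w = 0" unfolding simplex_boundary_def by blast
      have "(\<Sum>k<j. \<psi> x k) = 1 \<or> (\<exists>k<j. - \<psi> x k = 1)"
      proof (cases "w = w0")
        case True
        then show ?thesis using sum\<psi>[OF x(1)] x(3) by simp
      next
        case False
        then have "- \<psi> x (?\<gamma> w) = 1" using \<gamma>W[OF x(2)] x(3) by (simp add: \<psi>_def)
        then show ?thesis using \<gamma>W[OF x(2) False] by blast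
      qed
      then show "\<psi> x \<in> gauge_sphere j (simplex_gauge j)"
        using coord \<psi>ge[OF x(1)] \<psi>le[OF x(1)] unfolding gauge_sphere_def simplex_gauge_eq_iff by blast
    qed
    show "continuous_on (gauge_sphere j (simplex_gauge j)) \<phi>" unfolding \<phi>_def
    proof (rule continuous_on_coordinatewise_then_product)
      show "continuous_on (gauge_sphere j (simplex_gauge j))
         (\<lambda>y. if v = w0 then (1 - (\<Sum>k<j. y k)) / ?c else if v \<in> W then (y (?\<gamma> v) + 1) / ?c else 0)" for v
        by (cases "v = w0"; cases "v \<in> W") (auto intro!: continuous_intros)
    qed
    show "\<phi> ` gauge_sphere j (simplex_gauge j) \<subseteq> simplex_boundary W"
    proof (rule image_subsetI)
      fix y assume "y \<in> gauge_sphere j (simplex_gauge j)"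
      then have y: "(\<Sum>k<j. y k) \<le> 1" "\<And>k. k < j \<Longrightarrow> - y k \<le> 1"
        "(\<Sum>k<j. y k) = 1 \<or> (\<exists>k<j. - y k = 1)"
        unfolding gauge_sphere_def simplex_gauge_eq_iff by auto
      have "0 \<le> \<phi> y v" for v
        using y(1) y(2)[OF \<gamma>W(1), of v] by (auto simp: \<phi>_def)
      moreover have "\<phi> y v = 0" if "v \<notin> W" for v using that w0 by (auto simp: \<phi>_def)
      moreover have "(\<Sum>k<j. \<phi> y (\<beta> k)) = (\<Sum>k<j. (y k + 1) / ?c)"
        by (rule sum.cong) (simp_all add: \<phi>\<beta>)
      then have "sum (\<phi> y) W = 1"
        unfolding sumW \<phi>w0 by (simp add: sum.distrib sum_divide_distrib[symmetric] add_divide_distrib[symmetric])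
      moreover have "\<exists>w\<in>W. \<phi> y w = 0"
        using y(3)
      proof
        assume "(\<Sum>k<j. y k) = 1"
        then show ?thesis using w0 \<phi>w0[of y] by auto
      next
        assume "\<exists>k<j. - y k = 1"
        then obtain k where "k < j" "y k = - 1" by (metis minus_minus)
        then show ?thesis using \<phi>\<beta>[of k y] \<beta>W(1)[of k] by auto
      qed
      ultimately show "\<phi> y \<in> simplex_boundary W" unfolding simplex_boundary_def std_simplex_def by blast
    qed
    show "\<phi> (\<psi> x) = x" if "x \<in> simplex_boundary W" for x
    proof
      have x: "x \<in> std_simplex W" using that by (simp add: simplex_boundary_def)
      fix v
      consider "v = w0" | "v \<in> W" "v \<noteq> w0" | "v \<notin> W" by blast
      then show "\<phi> (\<psi> x) v = x v"
      proof cases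
        case 1
        then show ?thesis using \<phi>w0[of "\<psi> x"] sum\<psi>[OF x] by simp
      next
        case 2
        then show ?thesis using \<phi>\<beta>[OF \<gamma>W(1)[OF 2], of "\<psi> x"] \<gamma>W[OF 2] by (simp add: \<psi>_def)
      next
        case 3
        then show ?thesis using x w0 by (auto simp: \<phi>_def std_simplex_def)
      qed
    qed
    show "\<psi> (\<phi> y) = y" if "y \<in> gauge_sphere j (simplex_gauge j)" for y
    proof
      fix k
      show "\<psi> (\<phi> y) k = y k"
        using \<phi>\<beta>[of k y] that by (auto simp: \<psi>_def gauge_sphere_def coord_space_def)
    qed
  qed
qed

lemma filling_simplex:
  assumes "finite W" "card W = Suc j" "fillable j X"
  shows "filling (std_simplex W) (simplex_boundary W) X"
  by (rule simplex_chart[OF assms(1,2)], rule filling_transfer[OF filling_simplex_gauge[OF assms(3)]])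

lemma simplex_boundary_homeomorphic_sphere:
  assumes "finite W" "card W = Suc j"
  shows "simplex_boundary W homeomorphic gauge_sphere j (l2_gauge j)"
proof -
  have sub: "simplex_boundary W \<subseteq> std_simplex W" by (auto simp: simplex_boundary_def)
  obtain \<psi> :: "('a \<Rightarrow> real) \<Rightarrow> nat \<Rightarrow> real" and \<phi> :: "(nat \<Rightarrow> real) \<Rightarrow> 'a \<Rightarrow> real"
    where "continuous_on (std_simplex W) \<psi>" "\<psi> ` std_simplex W \<subseteq> gauge_ball j (simplex_gauge j)"
    "\<psi> ` simplex_boundary W \<subseteq> gauge_sphere j (simplex_gauge j)"
    "continuous_on (gauge_sphere j (simplex_gauge j)) \<phi>"
    "\<phi> ` gauge_sphere j (simplex_gauge j) \<subseteq> simplex_boundary W"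
    "\<And>x. x \<in> simplex_boundary W \<Longrightarrow> \<phi> (\<psi> x) = x"
    "\<And>y. y \<in> gauge_sphere j (simplex_gauge j) \<Longrightarrow> \<psi> (\<phi> y) = y"
    by (rule simplex_chart[OF assms]) (rule that; assumption)
  then have "simplex_boundary W homeomorphic gauge_sphere j (simplex_gauge j)"
    unfolding homeomorphic_minimal
    by (intro exI[of _ \<psi>] exI[of _ \<phi>]) (auto intro: continuous_on_subset[OF _ sub])
  then show ?thesis
    using homeomorphic_trans gauge_sphere_homeomorphic[OF gauge_on_simplex gauge_on_l2] by blast
qed

text \<open>With \<open>m + 2\<close> vertices the boundary is homeomorphic to
  \<open>nsphere m\<close>, and spheres are not contractible.\<close>

lemma not_contractible_simplex_boundary:
  assumes "finite W" "2 \<le> card W"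
  shows "\<not> contractible (simplex_boundary W)"
proof -
  define m where "m = card W - 2"
  have m: "card W = Suc (Suc m)" using assms(2) by (simp add: m_def)
  have "\<not> contractible (gauge_sphere (Suc m) (l2_gauge (Suc m)))"
    using non_contractible_space_nsphere[of m] unfolding nsphere_eq by simp
  then show ?thesis
    using homotopy_equivalent_space_contractibility[OF
        homeomorphic_imp_homotopy_eqv[OF simplex_boundary_homeomorphic_sphere[OF assms(1) m]]] by simp
qed

lemma sum_segment_point: "sum (segment_point t x y) A = (1 - t) * sum x A + t * sum y A"
  by (simp add: segment_point_def sum.distrib sum_distrib_left)

lemma segment_point_nonneg:
  "0 \<le> t \<Longrightarrow> t \<le> 1 \<Longrightarrow> 0 \<le> x v \<Longrightarrow> 0 \<le> y v \<Longrightarrow> 0 \<le> segment_point t x y v"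
  by (simp add: segment_point_def)

lemma segment_point_same_value: "x v = c \<Longrightarrow> y v = c \<Longrightarrow> segment_point t x y v = c"
  by (simp add: segment_point_def algebra_simps)

lemma segment_point_less:
  assumes "0 \<le> t" "t \<le> 1" "x v < c" "y v < c"
  shows "segment_point t x y v < c"
  unfolding segment_point_def using convex_bound_lt[OF assms(3,4), of "1 - t" t] assms(1,2) by simp

lemma segment_point_greater:
  assumes "0 \<le> t" "t \<le> 1" "c < x v" "c < y v"
  shows "c < segment_point t x y v"
  using segment_point_less[of t "\<lambda>v. - x v" v "- c" "\<lambda>v. - y v"] assms
  by (simp add: segment_point_def algebra_simps)

lemma simplex_segment:
  assumes "x \<in> std_simplex W" "y \<in> std_simplex W" "0 \<le> t" "t \<le> 1"
  shows "segment_point t x y \<in> std_simplex W"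
  using assms unfolding std_simplex_def mem_Collect_eq sum_segment_point
  by (auto intro: segment_point_nonneg segment_point_same_value)

lemma vertex_in_simplex: "finite W \<Longrightarrow> s \<in> W \<Longrightarrow> vertex s \<in> std_simplex W"
  by (simp add: std_simplex_def vertex_def)

lemma fillable_simplex:
  assumes "finite W" "W \<noteq> {}"
  shows "fillable j (std_simplex W)"
proof -
  obtain s where s: "s \<in> W" using assms by blast
  show ?thesis
    by (rule fillable_dominated_segment[OF fillable_singleton[of j "vertex s"], where p = "\<lambda>_. vertex s" and i = "\<lambda>x. x"])
       (use vertex_in_simplex[OF assms(1) s] simplex_segment in \<open>auto intro: continuous_intros\<close>)
qed

text \<open>Radial projection from the vertex \<open>s\<close> onto the opposite facet (junk at the vertex itself).\<close>

definition drop_vertex :: "'a \<Rightarrow> ('a \<Rightarrow> real) \<Rightarrow> 'a \<Rightarrow> real" where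
  "drop_vertex s x = (\<lambda>v. if v = s then 0 else x v / (1 - x s))"

lemma continuous_on_drop_vertex:
  assumes "\<And>x. x \<in> U \<Longrightarrow> x s < 1"
  shows "continuous_on U (drop_vertex s)"
  unfolding drop_vertex_def
proof (rule continuous_on_coordinatewise_then_product)
  show "continuous_on U (\<lambda>x. if v = s then 0 else x v / (1 - x s))" for v
    using assms by (cases "v = s") (force intro!: continuous_intros)+
qed

lemma drop_vertex_in_simplex:
  assumes "finite W" "s \<in> W" "x \<in> std_simplex W" "x s < 1"
  shows "drop_vertex s x \<in> std_simplex (W - {s})"
proof -
  have "sum (drop_vertex s x) (W - {s}) = (\<Sum>v\<in>W - {s}. x v / (1 - x s))"
    by (rule sum.cong) (auto simp: drop_vertex_def)
  also have "\<dots> = sum x (W - {s}) / (1 - x s)" by (simp add: sum_divide_distrib)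
  also have "sum x (W - {s}) = 1 - x s"
    using assms by (simp add: sum_diff1 std_simplex_def)
  finally show ?thesis using assms by (auto simp: std_simplex_def drop_vertex_def)
qed

lemma openin_Int_openI: "open T \<Longrightarrow> S = X \<inter> T \<Longrightarrow> openin (top_of_set X) S"
  by (auto simp: openin_open)

text \<open>Induction on the number of vertices. Away from the vertex \<open>s\<close> the boundary
  retracts onto the opposite facet; where \<open>x s > 0\<close> it is star-shaped about
  \<open>s\<close>; the overlap retracts onto the boundary of the opposite facet, with one vertex
  and one degree fewer. \<open>fillable_Un\<close> combines these.\<close>

lemma fillable_simplex_boundary:
  assumes "finite W" "j + 2 \<le> card W"
  shows "fillable j (simplex_boundary W)"
  using assms
proof (induction "card W" arbitrary: W j)
  case 0
  then show ?case by simp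
next
  case (Suc n)
  from Suc.prems obtain s where s: "s \<in> W" by fastforce
  let ?W = "W - {s}"
  have W: "finite ?W" "card ?W = n"
    using Suc.hyps(2) Suc.prems s by auto
  have "?W \<noteq> {}"
  proof
    assume "?W = {}"
    then have "n = 0" using W(2) by (metis card.empty)
    then show False using Suc.hyps(2) Suc.prems(2) by simp
  qed
  note W = W this
  then obtain s' where s': "s' \<in> ?W" by blast
  define U where "U = {x \<in> simplex_boundary W. x s < 1}"
  define V where "V = {x \<in> simplex_boundary W. 0 < x s}"
  have UV: "U \<union> V = simplex_boundary W" by (auto simp: U_def V_def)
  have W_sub: "x \<in> std_simplex W \<and> x s = 0" if "x \<in> std_simplex ?W" for x
    using that s Suc.prems(1) by (auto simp: std_simplex_def sum.remove[of W s])
  \<comment> \<open>If \<open>p\<close> vanishes wherever \<open>x\<close> does, a zero coordinate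
    of \<open>x\<close> persists along the whole segment, which thus stays in the boundary.\<close>
  have segU: "segment_point t p x \<in> simplex_boundary W"
    if h: "p \<in> std_simplex W" "x \<in> simplex_boundary W" "0 \<le> t" "t \<le> 1" "\<And>v. v \<in> W \<Longrightarrow> x v = 0 \<Longrightarrow> p v = 0" for t p x
  proof -
    obtain w where w: "w \<in> W" "x w = 0" "x \<in> std_simplex W" using h(2) unfolding simplex_boundary_def by blast
    then have "segment_point t p x w = 0" using segment_point_same_value[of p w 0 x t] h(5)[OF w(1,2)] by simp
    then show ?thesis using simplex_segment[OF h(1) w(3) h(3,4)] w(1) unfolding simplex_boundary_def by blast
  qed
  have dropW: "drop_vertex s x \<in> std_simplex ?W" if "x \<in> U" for x
    using drop_vertex_in_simplex[OF Suc.prems(1) s] that by (auto simp: U_def simplex_boundary_def)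
  have drop0: "drop_vertex s x v = 0" if "x v = 0" for x v using that by (simp add: drop_vertex_def)
  have cont_drop: "continuous_on A (drop_vertex s)" if "A \<subseteq> U" for A
    by (rule continuous_on_drop_vertex) (use that in \<open>auto simp: U_def\<close>)
  have fillU: "fillable i U" for i
  proof (rule fillable_dominated_segment[OF fillable_simplex[OF W(1,3)], where p = "drop_vertex s" and i = "\<lambda>x. x"])
    show "(\<lambda>x. x) ` std_simplex ?W \<subseteq> U"
    proof (rule image_subsetI)
      show "x \<in> U" if "x \<in> std_simplex ?W" for x
        using W_sub[OF that] s by (auto simp: U_def simplex_boundary_def)
    qed
    show "segment_point t (drop_vertex s x) x \<in> U" if "x \<in> U" "0 \<le> t" "t \<le> 1" for x t
    proof -
      have "segment_point t (drop_vertex s x) x s < 1"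
        by (rule segment_point_less) (use that in \<open>auto simp: drop_vertex_def U_def\<close>)
      moreover have "segment_point t (drop_vertex s x) x \<in> simplex_boundary W"
        by (rule segU) (use that W_sub[OF dropW[OF that(1)]] in \<open>simp_all add: U_def drop0\<close>)
      ultimately show ?thesis by (simp add: U_def)
    qed
  qed (use cont_drop dropW in \<open>auto intro: continuous_intros\<close>)
  have fillV: "fillable i V" for i
  proof (rule fillable_dominated_segment[OF fillable_singleton[of i "vertex s"], where p = "\<lambda>_. vertex s" and i = "\<lambda>x. x"])
    show "(\<lambda>x. x) ` {vertex s} \<subseteq> V"
      using vertex_in_simplex[OF Suc.prems(1) s] s' by (auto simp: V_def simplex_boundary_def vertex_def)
    show "segment_point t (vertex s) x \<in> V" if "x \<in> V" "0 \<le> t" "t \<le> 1" for x t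
    proof -
      have "0 < segment_point t (vertex s) x s"
        by (rule segment_point_greater) (use that in \<open>auto simp: vertex_def V_def\<close>)
      moreover have "segment_point t (vertex s) x \<in> simplex_boundary W"
        by (rule segU) (use that vertex_in_simplex[OF Suc.prems(1) s] in \<open>auto simp: V_def vertex_def[of s]\<close>)
      ultimately show ?thesis by (simp add: V_def)
    qed
  qed (auto intro: continuous_intros)
  show ?case
  proof (cases j)
    case 0
    then show ?thesis using fillU[of 0] UV unfolding 0 fillable_0 by blast
  next
    case (Suc j')
    have fillUV: "fillable i (U \<inter> V)" if "i < j" for i
    proof (rule fillable_dominated_segment)
      show "fillable i (simplex_boundary ?W)"
        using Suc.hyps(1)[of ?W i] W Suc.prems Suc.hyps(2) that by simp
      show "continuous_on (U \<inter> V) (drop_vertex s)" by (rule cont_drop) simp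
      show "drop_vertex s ` (U \<inter> V) \<subseteq> simplex_boundary ?W"
      proof (rule image_subsetI)
        fix x assume x: "x \<in> U \<inter> V"
        then obtain w where "w \<in> W" "x w = 0" "w \<noteq> s"
          unfolding V_def simplex_boundary_def by force
        then show "drop_vertex s x \<in> simplex_boundary ?W"
          using dropW[of x] drop0[of x w] x unfolding simplex_boundary_def by blast
      qed
      \<comment> \<open>The boundary of the opposite facet is embedded halfway towards
        \<open>s\<close>, at height \<open>x s = 1/2\<close>, inside both \<open>U\<close> and
        \<open>V\<close>.\<close>
      let ?i = "segment_point (1/2) (vertex s)"
      show "continuous_on (simplex_boundary ?W) ?i"
        by (intro continuous_on_segment_point continuous_intros)
      have half: "?i y s = 1/2" "?i y \<in> std_simplex W" if "y \<in> std_simplex ?W" for y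
      proof -
        show "?i y s = 1/2" using W_sub[OF that] by (simp add: segment_point_def vertex_def)
        show "?i y \<in> std_simplex W"
          by (rule simplex_segment[OF vertex_in_simplex[OF Suc.prems(1) s]]) (use W_sub[OF that] in simp_all)
      qed
      have half0: "?i y v = 0" if "y v = 0" "v \<noteq> s" for y v
        using that by (simp add: segment_point_def vertex_def)
      show "?i ` simplex_boundary ?W \<subseteq> U \<inter> V"
      proof (rule image_subsetI)
        fix y assume "y \<in> simplex_boundary ?W"
        then obtain w where "y \<in> std_simplex ?W" "w \<in> W" "w \<noteq> s" "y w = 0" by (auto simp: simplex_boundary_def)
        then show "?i y \<in> U \<inter> V"
          using half[of y] half0[of y w] by (auto simp: simplex_boundary_def U_def V_def)
      qed
      show "segment_point t (?i (drop_vertex s x)) x \<in> U \<inter> V"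
        if x: "x \<in> U \<inter> V" and t: "0 \<le> t" "t \<le> 1" for x t
      proof -
        have d: "drop_vertex s x \<in> std_simplex ?W" using dropW x by blast
        have xs: "0 < x s" "x s < 1" using x by (auto simp: U_def V_def)
        have "0 < segment_point t (?i (drop_vertex s x)) x s" "segment_point t (?i (drop_vertex s x)) x s < 1"
          by (rule segment_point_greater segment_point_less; use t xs half(1)[OF d] in simp)+
        moreover have "segment_point t (?i (drop_vertex s x)) x \<in> simplex_boundary W"
        proof (rule segU[OF half(2)[OF d] _ t])
          show "x \<in> simplex_boundary W" using x by (simp add: U_def)
          show "?i (drop_vertex s x) v = 0" if "x v = 0" for v
            by (rule half0) (use that xs drop0 in auto)
        qed
        ultimately show ?thesis by (simp add: U_def V_def)
      qed
    qed
    have "openin (top_of_set (U \<union> V)) U"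
      by (rule openin_Int_openI[of "{x. x s < 1}"])
         (unfold UV, auto simp: U_def intro!: open_Collect_less continuous_intros)
    moreover have "openin (top_of_set (U \<union> V)) V"
      by (rule openin_Int_openI[of "{x. 0 < x s}"])
         (unfold UV, auto simp: V_def intro!: open_Collect_less continuous_intros)
    ultimately show ?thesis
      using fillable_Un[of U V j] fillU fillV fillUV unfolding UV by simp
  qed
qed

section \<open>Realizations of finite complexes\<close>

definition realization :: "'a set set \<Rightarrow> ('a \<Rightarrow> real) set" where
  "realization K = {x. (\<forall>v. 0 \<le> x v) \<and> {v. x v \<noteq> 0} \<in> K \<and> (\<Sum>v | x v \<noteq> 0. x v) = 1}"

lemma geometric_realization_eq: "geometric_realization K = top_of_set (realization K)"
  unfolding geometric_realization_def realization_def euclidean_product_topology ..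

text \<open>Summing over a fixed finite vertex set instead of the varying support makes the total
  weight linear and continuous in \<open>x\<close>.\<close>

lemma realization_iff:
  assumes "finite T" "K \<subseteq> Pow T"
  shows "x \<in> realization K \<longleftrightarrow> (\<forall>v. 0 \<le> x v) \<and> {v. x v \<noteq> 0} \<in> K \<and> sum x T = 1"
proof -
  have "(\<Sum>v | x v \<noteq> 0. x v) = sum x T" if "{v. x v \<noteq> 0} \<in> K"
    by (rule sum.mono_neutral_left) (use assms that in auto)
  then show ?thesis unfolding realization_def by auto
qed

lemma realization_segment:
  assumes "finite T" "K \<subseteq> Pow T" and down: "\<And>\<sigma> \<tau>. \<sigma> \<in> K \<Longrightarrow> \<tau> \<subseteq> \<sigma> \<Longrightarrow> \<tau> \<in> K"
    and "x \<in> realization K" "y \<in> realization K" "{v. x v \<noteq> 0} \<union> {v. y v \<noteq> 0} \<in> K"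
    and "0 \<le> t" "t \<le> 1"
  shows "segment_point t x y \<in> realization K"
proof -
  have "{v. segment_point t x y v \<noteq> 0} \<subseteq> {v. x v \<noteq> 0} \<union> {v. y v \<noteq> 0}"
    using segment_point_same_value[of x _ 0 y t] by blast
  then have "{v. segment_point t x y v \<noteq> 0} \<in> K" using down[OF assms(6)] by blast
  then show ?thesis
    using assms(4,5,7,8) unfolding realization_iff[OF assms(1,2)] sum_segment_point
    by (simp add: segment_point_nonneg)
qed

lemma continuous_on_coordinate_sum: "continuous_on X (\<lambda>x. sum x P)" for X :: "('a \<Rightarrow> real) set"
  by (intro continuous_on_sum continuous_on_coordinate)

lemma sum_segment_less:
  assumes "0 \<le> t" "t \<le> 1" "sum x A < c" "sum y A < (c::real)"
  shows "sum (segment_point t x y) A < c"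
  unfolding sum_segment_point using convex_bound_lt[OF assms(3,4), of "1 - t" t] assms(1,2) by simp

text \<open>Deleting the weight on \<open>Q\<close> and dividing by the remaining weight retracts
  onto the subcomplex that avoids \<open>Q\<close>. The support only shrinks, so the segment back to
  \<open>x\<close> stays in a simplex of \<open>K\<close>.\<close>

lemma fillable_sum_less_1:
  assumes "finite T" "K \<subseteq> Pow T" and down: "\<And>\<sigma> \<tau>. \<sigma> \<in> K \<Longrightarrow> \<tau> \<subseteq> \<sigma> \<Longrightarrow> \<tau> \<in> K"
    and "Q \<subseteq> T" "fillable j (realization {\<sigma> \<in> K. \<sigma> \<inter> Q = {}})"
  shows "fillable j {x \<in> realization K. sum x Q < 1}"
proof -
  let ?K = "{\<sigma> \<in> K. \<sigma> \<inter> Q = {}}" and ?U = "{x \<in> realization K. sum x Q < 1}"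
  have K': "?K \<subseteq> Pow T" using assms(2) by blast
  define p :: "('a \<Rightarrow> real) \<Rightarrow> 'a \<Rightarrow> real" where "p = (\<lambda>x v. if v \<in> Q then 0 else x v / (1 - sum x Q))"
  have supp: "{v. p x v \<noteq> 0} = {v. x v \<noteq> 0} - Q" if "x \<in> ?U" for x
    using that by (auto simp: p_def)
  have mem: "p x \<in> realization ?K" if x: "x \<in> ?U" for x
  proof -
    have X: "\<And>v. 0 \<le> x v" "{v. x v \<noteq> 0} \<in> K" "sum x T = 1" "sum x Q < 1"
      using x unfolding realization_iff[OF assms(1,2)] by auto
    have "sum (p x) T = sum (p x) (T - Q)"
      by (rule sum.mono_neutral_right) (use assms(1) in \<open>auto simp: p_def\<close>)
    also have "\<dots> = (\<Sum>v\<in>T - Q. x v / (1 - sum x Q))" by (rule sum.cong) (auto simp: p_def)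
    also have "\<dots> = sum x (T - Q) / (1 - sum x Q)" by (simp add: sum_divide_distrib)
    also have "sum x (T - Q) = 1 - sum x Q" using X assms(1,4) by (simp add: sum_diff)
    finally have "sum (p x) T = 1" using X(4) by simp
    moreover have "{v. p x v \<noteq> 0} \<in> K" unfolding supp[OF x] by (rule down[OF X(2)]) blast
    then have "{v. p x v \<noteq> 0} \<in> ?K" unfolding supp[OF x] by auto
    ultimately show ?thesis using X unfolding realization_iff[OF assms(1) K'] by (auto simp: p_def)
  qed
  have sub: "realization ?K \<subseteq> ?U"
  proof
    fix x assume x: "x \<in> realization ?K"
    then have "sum x Q = 0" unfolding realization_iff[OF assms(1) K'] by (auto intro!: sum.neutral)
    then show "x \<in> ?U" using x unfolding realization_iff[OF assms(1) K'] realization_iff[OF assms(1,2)] by simp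
  qed
  show ?thesis
  proof (rule fillable_dominated_segment[OF assms(5), where p = p and i = "\<lambda>x. x"])
    show "continuous_on ?U p" unfolding p_def
    proof (rule continuous_on_coordinatewise_then_product)
      show "continuous_on ?U (\<lambda>x. if v \<in> Q then 0 else x v / (1 - sum x Q))" for v
        by (cases "v \<in> Q") (auto intro!: continuous_intros continuous_on_coordinate_sum)
    qed
    show "segment_point t (p x) x \<in> ?U" if x: "x \<in> ?U" and t: "0 \<le> t" "t \<le> 1" for x t
    proof -
      have px: "p x \<in> ?U" using mem[OF x] sub by blast
      have "{v. p x v \<noteq> 0} \<union> {v. x v \<noteq> 0} = {v. x v \<noteq> 0}" unfolding supp[OF x] by blast
      then have "{v. p x v \<noteq> 0} \<union> {v. x v \<noteq> 0} \<in> K" using x by (simp add: realization_def)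
      then have "segment_point t (p x) x \<in> realization K"
        by (intro realization_segment[OF assms(1,2) _ _ _ _ t]) (use down px x in auto)
      then show ?thesis using sum_segment_less[OF t, of "p x" Q 1 x] px x by simp
    qed
  qed (use mem sub in \<open>auto intro: continuous_on_id\<close>)
qed

section \<open>Facet-preserving maps of a simplex boundary\<close>

lemma homotopic_with_canonI:
  fixes f g :: "'a::topological_space \<Rightarrow> 'b::topological_space"
  assumes "continuous_on ({0..1::real} \<times> S) h" "h ` ({0..1} \<times> S) \<subseteq> T"
    "\<And>x. x \<in> S \<Longrightarrow> h (0, x) = f x" "\<And>x. x \<in> S \<Longrightarrow> h (1, x) = g x"
  shows "homotopic_with_canon (\<lambda>_. True) S T f g"
proof (subst homotopic_with)
  show "\<exists>h. continuous_map (prod_topology (top_of_set {0..1::real}) (top_of_set S)) (top_of_set T) h \<and>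
     (\<forall>x\<in>topspace (top_of_set S). h (0, x) = f x) \<and> (\<forall>x\<in>topspace (top_of_set S). h (1, x) = g x) \<and>
     (\<forall>t\<in>{0..1}. True)"
    using assms by (intro exI[of _ h]) (auto simp: prod_topology_subtopology_eu)
qed auto

lemma std_simplex_facet:
  assumes "finite W" "x \<in> std_simplex (insert w W)" "x w = 0"
  shows "x \<in> std_simplex W"
  using assms by (cases "w \<in> W") (auto simp: std_simplex_def insert_absorb)

lemma closed_std_simplex: "closed (std_simplex W)"
proof -
  have "std_simplex W = (\<Inter>v. {x. 0 \<le> x v}) \<inter> (\<Inter>v\<in>- W. {x. x v = 0}) \<inter> {x. sum x W = 1}"
    by (auto simp: std_simplex_def)
  then show ?thesis
    by (auto intro!: closed_Int closed_INT closed_Collect_le closed_Collect_eq continuous_intros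
        continuous_on_coordinate_sum)
qed

text \<open>On the boundary, \<open>q\<close> is homotopic to the identity, since \<open>x\<close>
  and \<open>q x\<close> share a facet and the segment between them stays in it. It is also
  null-homotopic: \<open>q\<close> is defined on the whole simplex, where points can be moved to the
  vertex \<open>w0\<close>.\<close>

lemma contractible_of_facet_preserving:
  assumes "finite W" "w0 \<in> W" "continuous_on (std_simplex W) q" "q ` std_simplex W \<subseteq> simplex_boundary W"
    and facet: "\<And>x. x \<in> simplex_boundary W \<Longrightarrow> \<exists>w\<in>W. x w = 0 \<and> q x w = 0"
  shows "contractible (simplex_boundary W)"
proof -
  let ?D = "std_simplex W" and ?T = "simplex_boundary W"
  have TD: "?T \<subseteq> ?D" by (auto simp: simplex_boundary_def)
  have cont_q: "continuous_on ?T q" using assms(3) TD by (rule continuous_on_subset)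
  have "homotopic_with_canon (\<lambda>_. True) ?T ?T id q"
  proof (rule homotopic_with_canonI)
    show "continuous_on ({0..1} \<times> ?T) (\<lambda>z. segment_point (fst z) (snd z) (q (snd z)))"
      by (intro continuous_on_segment_point continuous_on_fst continuous_on_snd continuous_on_id
          continuous_on_compose2[OF cont_q]) auto
    show "(\<lambda>z. segment_point (fst z) (snd z) (q (snd z))) ` ({0..1} \<times> ?T) \<subseteq> ?T"
    proof (rule image_subsetI)
      fix z assume "z \<in> {0..1::real} \<times> ?T"
      then obtain t x where z: "z = (t, x)" "0 \<le> t" "t \<le> 1" "x \<in> ?T" by auto
      obtain w where w: "w \<in> W" "x w = 0" "q x w = 0" using facet[OF z(4)] by blast
      have "segment_point t x (q x) \<in> ?D"
        by (rule simplex_segment) (use z TD assms(4) in auto)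
      then show "segment_point (fst z) (snd z) (q (snd z)) \<in> ?T"
        using segment_point_same_value[of x w 0 "q x"] w z(1) by (auto simp: simplex_boundary_def)
    qed
  qed (auto simp: segment_point_def)
  moreover have "homotopic_with_canon (\<lambda>_. True) ?T ?T q (\<lambda>_. q (vertex w0))"
  proof (rule homotopic_with_canonI)
    have sub: "(\<lambda>z. segment_point (fst z) (snd z) (vertex w0)) ` ({0..1} \<times> ?T) \<subseteq> ?D"
      using TD vertex_in_simplex[OF assms(1,2)] by (auto intro!: simplex_segment)
    show "continuous_on ({0..1} \<times> ?T) (\<lambda>z. q (segment_point (fst z) (snd z) (vertex w0)))"
      by (rule continuous_on_compose2[OF assms(3) _ sub])
         (intro continuous_on_segment_point continuous_on_fst continuous_on_snd continuous_on_id continuous_on_const)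
    show "(\<lambda>z. q (segment_point (fst z) (snd z) (vertex w0))) ` ({0..1} \<times> ?T) \<subseteq> ?T"
      using sub assms(4) by (auto simp: image_subset_iff)
  qed (auto simp: segment_point_def)
  ultimately show ?thesis unfolding contractible_def by (blast intro: homotopic_with_trans)
qed

section \<open>Two complexes glued along a simplex\<close>

text \<open>These are the properties of the neighbourhood complex that the topology relies on; no
  graph occurs. They are symmetric in the two sides, so statements about \<open>X1\<close> transfer
  to \<open>X2\<close>.\<close>

locale glued_complex =
  fixes K :: "'a set set" and P Q S :: "'a set" and a b :: 'a
  assumes finite: "finite P" "finite Q" "finite S"
    and disjoint: "P \<inter> Q = {}" "P \<inter> S = {}" "Q \<inter> S = {}"
    and K_sub: "K \<subseteq> Pow (P \<union> Q \<union> S)"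
    and down: "\<sigma> \<in> K \<Longrightarrow> \<tau> \<subseteq> \<sigma> \<Longrightarrow> \<tau> \<in> K"
    and a: "a \<in> P" and b: "b \<in> Q"
    and S_in_K: "S \<in> K"
    and facets: "w \<in> S \<Longrightarrow> {a, b} \<union> (S - {w}) \<in> K"
    and mixed: "\<sigma> \<in> K \<Longrightarrow> \<sigma> \<inter> P \<noteq> {} \<Longrightarrow> \<sigma> \<inter> Q \<noteq> {} \<Longrightarrow> \<exists>w\<in>S. w \<notin> \<sigma> \<and> \<sigma> \<union> {a, b} \<union> (S - {w}) \<in> K"
begin

abbreviation "X \<equiv> realization K"
abbreviation "X1 \<equiv> realization {\<sigma> \<in> K. \<sigma> \<inter> Q = {}}"
abbreviation "X2 \<equiv> realization {\<sigma> \<in> K. \<sigma> \<inter> P = {}}"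

lemma finite_vertices: "finite (P \<union> Q \<union> S)"
  using finite by blast

lemmas X_iff = realization_iff[OF finite_vertices K_sub]

lemma X1_iff: "x \<in> X1 \<longleftrightarrow> x \<in> X \<and> (\<forall>v\<in>Q. x v = 0)"
  unfolding realization_def by auto

lemma X2_iff: "x \<in> X2 \<longleftrightarrow> x \<in> X \<and> (\<forall>v\<in>P. x v = 0)"
  unfolding realization_def by auto

lemma sum_vertices: "sum f (P \<union> Q \<union> S) = sum f P + sum f Q + sum f S" for f :: "'a \<Rightarrow> real"
proof -
  have "(P \<union> Q) \<inter> S = {}" using disjoint by blast
  then show ?thesis using finite disjoint(1) by (simp add: sum.union_disjoint)
qed

lemma sum_X: "x \<in> X \<Longrightarrow> sum x P + sum x Q + sum x S = 1"
  using X_iff sum_vertices by metis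

lemma nonneg_X: "x \<in> X \<Longrightarrow> 0 \<le> x v"
  using X_iff by blast

lemma sum_nonneg_X: "x \<in> X \<Longrightarrow> 0 \<le> sum x A"
  by (simp add: sum_nonneg nonneg_X)

lemma ab: "a \<noteq> b" "a \<notin> S" "b \<notin> S" "a \<notin> Q" "b \<notin> P"
  using a b disjoint by auto

lemma mixed_X:
  assumes "x \<in> X" "sum x P \<noteq> 0" "sum x Q \<noteq> 0"
  obtains w where "w \<in> S" "x w = 0" "{v. x v \<noteq> 0} \<union> {a, b} \<union> (S - {w}) \<in> K"
proof -
  have "{v. x v \<noteq> 0} \<inter> P \<noteq> {}" "{v. x v \<noteq> 0} \<inter> Q \<noteq> {}"
    using assms(2,3) by (auto intro: sum.neutral)
  then show ?thesis using mixed[of "{v. x v \<noteq> 0}"] assms(1) that unfolding X_iff by auto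
qed

text \<open>The facet opposite \<open>a\<close> is \<open>S\<close> itself; every other facet omits
  some \<open>w \<in> S\<close> and is covered by \<open>facets\<close>.\<close>

lemma boundary_aS_subset: "simplex_boundary (insert a S) \<subseteq> X1"
proof
  fix x assume x: "x \<in> simplex_boundary (insert a S)"
  then obtain w where w: "w \<in> insert a S" "x w = 0" by (auto simp: simplex_boundary_def)
  have x0: "x v = 0" if "v \<noteq> a" "v \<notin> S" for v using x that by (simp add: simplex_boundary_def std_simplex_def)
  have "{v. x v \<noteq> 0} \<in> K"
  proof (cases "w = a")
    case True
    then have "{v. x v \<noteq> 0} \<subseteq> S" using w(2) x0 by (metis (mono_tags, lifting) mem_Collect_eq subsetI)
    then show ?thesis by (rule down[OF S_in_K])
  next
    case False
    then have "w \<in> S" using w(1) by blast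
    moreover have "{v. x v \<noteq> 0} \<subseteq> {a, b} \<union> (S - {w})" using w(2) x0 by blast
    ultimately show ?thesis using down[OF facets] by blast
  qed
  moreover have "sum x (P \<union> Q \<union> S) = sum x (insert a S)"
    by (rule sum.mono_neutral_right) (use finite a x0 in auto)
  ultimately have "x \<in> X" using x unfolding X_iff simplex_boundary_def std_simplex_def by simp
  moreover have "x v = 0" if "v \<in> Q" for v by (rule x0) (use that ab disjoint in auto)
  ultimately show "x \<in> X1" unfolding X1_iff by simp
qed

section \<open>Lower bound for the connectivity\<close>

lemma fillable_X:
  assumes "\<And>j. j \<le> card S \<Longrightarrow> fillable j X1" "\<And>j. j \<le> card S \<Longrightarrow> fillable j X2" "d \<le> card S"
  shows "fillable d X"
proof -
  define U where "U = {x \<in> X. sum x Q < 1}"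
  define V where "V = {x \<in> X. sum x P < 1}"
  have UV: "U \<union> V = X"
  proof -
    have "sum x Q < 1 \<or> sum x P < 1" if "x \<in> X" for x
      using sum_X[OF that] sum_nonneg_X[OF that, of S] by linarith
    then show ?thesis unfolding U_def V_def by blast
  qed
  have fill: "fillable j U" "fillable j V" if "j \<le> card S" for j
    unfolding U_def V_def
    by (intro fillable_sum_less_1[OF finite_vertices K_sub] assms that; (erule (1) down | blast))+
  have fillUV: "fillable i (U \<inter> V)" if i: "i < card S" for i
  proof -
    let ?T = "simplex_boundary (insert a S)"
    \<comment> \<open>The smaller of the weights on \<open>P\<close> and \<open>Q\<close>, doubled,
      is placed at \<open>a\<close>; together with the weights on \<open>S\<close>, normalized by
      \<open>D x\<close>, it defines \<open>p x\<close>. Conversely \<open>\<iota>\<close> splits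
      the weight at \<open>a\<close> evenly between \<open>a\<close> and \<open>b\<close>, leaving
      at most 1/2 on each side.\<close>
    define \<mu> where "\<mu> x = min (sum x P) (sum x Q)" for x :: "'a \<Rightarrow> real"
    define D where "D x = 2 * \<mu> x + sum x S" for x :: "'a \<Rightarrow> real"
    define p where "p x v = (if v = a then 2 * \<mu> x / D x else if v \<in> S then x v / D x else 0)" for x v
    define \<iota> where "\<iota> y v = (if v = a \<or> v = b then y a / 2 else if v \<in> S then y v else 0)"
      for y :: "'a \<Rightarrow> real" and v
    have \<mu>0: "0 \<le> \<mu> x" if "x \<in> X" for x using sum_nonneg_X[OF that] by (simp add: \<mu>_def)
    \<comment> \<open>If \<open>D x\<close> vanished, \<open>S\<close> and one of \<open>P\<close>,
      \<open>Q\<close> would carry no weight; the other would carry all of it, contrary to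
      membership in \<open>U\<close> and \<open>V\<close>.\<close>
    have Dpos: "0 < D x" if "x \<in> U \<inter> V" for x
    proof -
      have x: "x \<in> X" "sum x P < 1" "sum x Q < 1" using that by (auto simp: U_def V_def)
      show ?thesis
        using sum_X[OF x(1)] x(2,3) sum_nonneg_X[OF x(1), of P] sum_nonneg_X[OF x(1), of Q] sum_nonneg_X[OF x(1), of S]
        unfolding D_def \<mu>_def by linarith
    qed
    have pT: "p x \<in> ?T" if xUV: "x \<in> U \<inter> V" for x
    proof -
      have x: "x \<in> X" using xUV by (auto simp: U_def)
      have "sum (p x) S = (\<Sum>v\<in>S. x v / D x)" by (rule sum.cong) (use ab in \<open>auto simp: p_def\<close>)
      then have "sum (p x) (insert a S) = 1"
        using finite ab Dpos[OF xUV] by (simp add: p_def sum_divide_distrib[symmetric] add_divide_distrib[symmetric] D_def)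
      moreover have "0 \<le> p x v" for v
        using Dpos[OF xUV] \<mu>0[OF x] nonneg_X[OF x] by (simp add: p_def)
      ultimately have "p x \<in> std_simplex (insert a S)" by (auto simp: std_simplex_def p_def)
      \<comment> \<open>Either one side carries no weight, and then the coordinate at
        \<open>a\<close> is 0, or the support is mixed and omits a vertex of
        \<open>S\<close>.\<close>
      moreover have "\<exists>w\<in>insert a S. p x w = 0"
      proof (cases "\<mu> x = 0")
        case True
        then show ?thesis by (simp add: p_def)
      next
        case False
        then have "sum x P \<noteq> 0" "sum x Q \<noteq> 0"
          using sum_nonneg_X[OF x, of P] sum_nonneg_X[OF x, of Q] by (auto simp: \<mu>_def)
        then obtain w where "w \<in> S" "x w = 0" by (rule mixed_X[OF x])
        then show ?thesis using ab by (intro bexI[of _ w]) (auto simp: p_def)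
      qed
      ultimately show ?thesis by (simp add: simplex_boundary_def)
    qed
    have \<iota>UV: "\<iota> y \<in> U \<inter> V" if y: "y \<in> ?T" for y
    proof -
      have yX: "y \<in> X1" using boundary_aS_subset y by blast
      have y0: "0 \<le> y v" for v using y by (simp add: simplex_boundary_def std_simplex_def)
      have ysum: "y a + sum y S = 1" using y finite ab by (simp add: simplex_boundary_def std_simplex_def)
      obtain w where w: "w \<in> insert a S" "y w = 0" using y by (auto simp: simplex_boundary_def)
      have "{v. \<iota> y v \<noteq> 0} \<in> K"
      proof (cases "w = a")
        case True
        then show ?thesis using w by (intro down[OF S_in_K]) (auto simp: \<iota>_def)
      next
        case False
        then show ?thesis using w ab by (intro down[OF facets[of w]]) (auto simp: \<iota>_def)
      qed
      moreover have sums: "sum (\<iota> y) P = y a / 2" "sum (\<iota> y) Q = y a / 2" "sum (\<iota> y) S = sum y S"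
      proof -
        have "sum (\<iota> y) P = sum (\<iota> y) {a}"
          by (rule sum.mono_neutral_right) (use finite a ab disjoint in \<open>auto simp: \<iota>_def\<close>)
        then show "sum (\<iota> y) P = y a / 2" by (simp add: \<iota>_def)
        have "sum (\<iota> y) Q = sum (\<iota> y) {b}"
          by (rule sum.mono_neutral_right) (use finite b ab disjoint in \<open>auto simp: \<iota>_def\<close>)
        then show "sum (\<iota> y) Q = y a / 2" by (simp add: \<iota>_def)
        show "sum (\<iota> y) S = sum y S" by (rule sum.cong) (use ab in \<open>auto simp: \<iota>_def\<close>)
      qed
      moreover have "0 \<le> \<iota> y v" for v using y0 by (simp add: \<iota>_def)
      moreover have "y a \<le> 1" using ysum sum_nonneg[of S y] y0 by simp
      ultimately show ?thesis using ysum unfolding U_def V_def X_iff sum_vertices by simp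
    qed
    show ?thesis
    proof (rule fillable_dominated_segment)
      show "fillable i ?T"
        by (rule fillable_simplex_boundary) (use i finite ab in auto)
      show "continuous_on (U \<inter> V) p"
      proof (rule continuous_on_coordinatewise_then_product)
        have \<mu>c: "continuous_on (U \<inter> V) \<mu>" unfolding \<mu>_def[abs_def]
          by (intro continuous_intros continuous_on_coordinate_sum)
        then have Dc: "continuous_on (U \<inter> V) D" unfolding D_def[abs_def]
          by (intro continuous_intros continuous_on_coordinate_sum)
        have D0: "\<forall>x\<in>U \<inter> V. D x \<noteq> 0" using Dpos by force
        show "continuous_on (U \<inter> V) (\<lambda>x. p x v)" for v
          unfolding p_def using D0
          by (cases "v = a"; cases "v \<in> S") (auto intro!: continuous_intros \<mu>c Dc)
      qed
      show "p ` (U \<inter> V) \<subseteq> ?T" using pT by blast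
      show "continuous_on ?T \<iota>"
      proof (rule continuous_on_coordinatewise_then_product)
        show "continuous_on ?T (\<lambda>y. \<iota> y v)" for v
          unfolding \<iota>_def by (cases "v = a \<or> v = b"; cases "v \<in> S") (auto intro!: continuous_intros)
      qed
      show "\<iota> ` ?T \<subseteq> U \<inter> V" using \<iota>UV by blast
      show "segment_point t (\<iota> (p x)) x \<in> U \<inter> V" if xUV: "x \<in> U \<inter> V" and t: "0 \<le> t" "t \<le> 1" for x t
      proof -
        have x: "x \<in> X" "sum x P < 1" "sum x Q < 1" using xUV by (auto simp: U_def V_def)
        have y: "\<iota> (p x) \<in> X" "sum (\<iota> (p x)) P < 1" "sum (\<iota> (p x)) Q < 1"
          using \<iota>UV[OF pT[OF xUV]] by (auto simp: U_def V_def)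
        have supp: "v \<in> {a, b} \<and> \<mu> x \<noteq> 0 \<or> v \<in> S \<and> x v \<noteq> 0" if "\<iota> (p x) v \<noteq> 0" for v
          using that by (auto simp: \<iota>_def p_def split: if_splits)
        \<comment> \<open>For \<open>\<mu> x = 0\<close> nothing outside the support of
          \<open>x\<close> is used. Otherwise both supports lie in the enlarged simplex provided by
          \<open>mixed_X\<close>.\<close>
        have "{v. \<iota> (p x) v \<noteq> 0} \<union> {v. x v \<noteq> 0} \<in> K"
        proof (cases "\<mu> x = 0")
          case True
          then have "{v. \<iota> (p x) v \<noteq> 0} \<union> {v. x v \<noteq> 0} = {v. x v \<noteq> 0}" using supp by blast
          then show ?thesis using x(1) X_iff by simp
        next
          case False
          then have "sum x P \<noteq> 0" "sum x Q \<noteq> 0"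
            using sum_nonneg_X[OF x(1), of P] sum_nonneg_X[OF x(1), of Q] by (auto simp: \<mu>_def)
          then obtain w where w: "w \<in> S" "x w = 0" "{v. x v \<noteq> 0} \<union> {a, b} \<union> (S - {w}) \<in> K"
            by (rule mixed_X[OF x(1)])
          show ?thesis
            by (rule down[OF w(3)]) (use supp w(2) in blast)
        qed
        then have "segment_point t (\<iota> (p x)) x \<in> X"
          by (intro realization_segment[OF finite_vertices K_sub _ y(1) x(1) _ t]) (use down in auto)
        then show ?thesis
          using sum_segment_less[OF t y(2) x(2)] sum_segment_less[OF t y(3) x(3)]
          unfolding U_def V_def by blast
      qed
    qed
  qed
  have "openin (top_of_set (U \<union> V)) U"
    by (rule openin_Int_openI[of "{x. sum x Q < 1}"])
       (unfold UV, auto simp: U_def intro!: open_Collect_less continuous_intros continuous_on_coordinate_sum)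
  moreover have "openin (top_of_set (U \<union> V)) V"
    by (rule openin_Int_openI[of "{x. sum x P < 1}"])
       (unfold UV, auto simp: V_def intro!: open_Collect_less continuous_intros continuous_on_coordinate_sum)
  ultimately show ?thesis
    using fillable_Un[of U V d] fill fillUV assms(3) unfolding UV by simp
qed

section \<open>Upper bound for the connectivity\<close>

lemma facet_extension:
  assumes "fillable (card S) X1"
  obtains g where "continuous_on (std_simplex (insert a S)) g" "g ` std_simplex (insert a S) \<subseteq> X1"
    "\<And>x. x \<in> simplex_boundary (insert a S) \<Longrightarrow> g x = x"
proof -
  \<comment> \<open>The set \<open>insert a S\<close> itself need not belong to \<open>K\<close>,
    only its proper faces do. The inclusion of its boundary is therefore extended over the solid
    simplex inside \<open>X1\<close>.\<close>
  have "filling (std_simplex (insert a S)) (simplex_boundary (insert a S)) X1"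
    by (rule filling_simplex[OF _ _ assms]) (use finite ab in auto)
  then show ?thesis
    by (rule fillingE[where f = "\<lambda>x. x"]) (use boundary_aS_subset that in auto)
qed


lemma glued_swap: "glued_complex K Q P S b a"
proof
  show "\<exists>w\<in>S. w \<notin> \<sigma> \<and> \<sigma> \<union> {b, a} \<union> (S - {w}) \<in> K"
    if "\<sigma> \<in> K" "\<sigma> \<inter> Q \<noteq> {}" "\<sigma> \<inter> P \<noteq> {}" for \<sigma>
    using mixed[OF that(1,3,2)] by (simp add: insert_commute)
  show "{b, a} \<union> (S - {w}) \<in> K" if "w \<in> S" for w
    using facets[OF that] by (simp add: insert_commute)
qed (use finite disjoint K_sub down a b S_in_K in \<open>auto simp: Un_commute\<close>)

definition collapse :: "('a \<Rightarrow> real) \<Rightarrow> 'a \<Rightarrow> real" where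
  "collapse x = (\<lambda>v. if v = a then sum x P else if v = b then sum x Q else if v \<in> S then x v else 0)"

lemma collapse_in_boundary:
  assumes x: "x \<in> X"
  shows "collapse x \<in> simplex_boundary (insert a (insert b S))"
proof -
  have "sum (collapse x) S = sum x S" by (rule sum.cong) (use ab in \<open>auto simp: collapse_def\<close>)
  then have "sum (collapse x) (insert a (insert b S)) = 1"
    using finite ab sum_X[OF x] by (simp add: collapse_def)
  moreover have "0 \<le> collapse x v" for v
    using sum_nonneg_X[OF x] nonneg_X[OF x] by (simp add: collapse_def)
  moreover have "\<exists>w\<in>insert a (insert b S). collapse x w = 0"
  proof (cases "sum x P = 0 \<or> sum x Q = 0")
    case True
    then show ?thesis using ab by (auto simp: collapse_def)
  next
    case False
    then obtain w where "w \<in> S" "x w = 0" using mixed_X[OF x] by metis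
    then show ?thesis using ab by (intro bexI[of _ w]) (auto simp: collapse_def)
  qed
  ultimately show ?thesis by (simp add: simplex_boundary_def std_simplex_def collapse_def)
qed

lemma not_fillable_X:
  assumes X1: "fillable (card S) X1" and X2: "fillable (card S) X2"
  shows "\<not> fillable (Suc (card S)) X"
proof
  assume fillX: "fillable (Suc (card S)) X"
  let ?W = "insert a (insert b S)" and ?Sa = "insert a S" and ?Sb = "insert b S"
  let ?T = "simplex_boundary ?W"
  have finW: "finite ?W" and cardW: "card ?W = Suc (Suc (card S))" using finite ab by auto
  obtain g1 where g1: "continuous_on (std_simplex ?Sa) g1" "g1 ` std_simplex ?Sa \<subseteq> X1"
    "\<And>x. x \<in> simplex_boundary ?Sa \<Longrightarrow> g1 x = x"
    by (rule facet_extension[OF X1]) (rule that; assumption)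
  obtain g2 where g2: "continuous_on (std_simplex ?Sb) g2" "g2 ` std_simplex ?Sb \<subseteq> X2"
    "\<And>x. x \<in> simplex_boundary ?Sb \<Longrightarrow> g2 x = x"
    by (rule glued_complex.facet_extension[OF glued_swap X2]) (rule that; assumption)
  \<comment> \<open>A closed cover of the boundary: the facets omitting \<open>b\<close>, omitting
    \<open>a\<close>, and omitting some vertex of \<open>S\<close>.\<close>
  define T1 where "T1 = ?T \<inter> {x. x b = 0}"
  define T2 where "T2 = ?T \<inter> {x. x a = 0}"
  define T0 where "T0 = ?T \<inter> (\<Union>w\<in>S. {x. x w = 0})"
  have T: "T1 \<union> (T2 \<union> T0) = ?T" unfolding T1_def T2_def T0_def simplex_boundary_def by auto
  have clT: "closed ?T"
  proof -
    have "?T = std_simplex ?W \<inter> (\<Union>w\<in>?W. {x. x w = 0})" by (auto simp: simplex_boundary_def)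
    then show ?thesis
      using finW by (auto intro!: closed_Int closed_std_simplex closed_UN closed_Un closed_Collect_eq continuous_intros)
  qed
  have cl: "closed T1" "closed T2" "closed T0"
    unfolding T1_def T2_def T0_def using finite clT
    by (auto intro!: closed_Int closed_UN closed_Collect_eq continuous_intros)
  have T1: "x \<in> std_simplex ?Sa" if "x \<in> T1" for x
    using std_simplex_facet[of ?Sa x b] that finite by (simp add: T1_def simplex_boundary_def insert_commute)
  have T2: "x \<in> std_simplex ?Sb" if "x \<in> T2" for x
    using std_simplex_facet[of ?Sb x a] that finite by (simp add: T2_def simplex_boundary_def)
  have g1_id: "g1 x = x" if "x \<in> T1" "w \<in> ?Sa" "x w = 0" for x w
    using g1(3)[of x] T1[OF that(1)] that(2,3) unfolding simplex_boundary_def by blast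
  have g2_id: "g2 x = x" if "x \<in> T2" "w \<in> ?Sb" "x w = 0" for x w
    using g2(3)[of x] T2[OF that(1)] that(2,3) unfolding simplex_boundary_def by blast
  \<comment> \<open>The map is glued in two stages from \<open>g1\<close>, \<open>g2\<close> and the
    identity. On overlaps a further coordinate vanishes, so \<open>g1\<close> or \<open>g2\<close>
    acts on a boundary point of its facet and fixes it.\<close>
  define h where "h x = (if x a = 0 then g2 x else x)" for x
  define f where "f x = (if x b = 0 then g1 x else h x)" for x
  have h_id: "h x = x" if "x \<in> T2 \<union> T0" "w \<in> ?Sb" "x w = 0" for x w
  proof (cases "x a = 0")
    case True
    then have "x \<in> T2" using that(1) by (auto simp: T2_def T0_def)
    then show ?thesis using g2_id[of x w] that(2,3) True by (simp add: h_def)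
  qed (simp add: h_def)
  have f_id: "f x = x" if "x \<in> ?T" "w \<in> S" "x w = 0" for x w
  proof (cases "x b = 0")
    case True
    then have "x \<in> T1" using that(1) by (simp add: T1_def)
    then show ?thesis using g1_id[of x w] that True by (simp add: f_def)
  next
    case False
    have "x \<in> T2 \<union> T0" using that by (auto simp: T0_def)
    then show ?thesis using h_id[of x w] that False by (simp add: f_def)
  qed
  have "continuous_on (T2 \<union> T0) h" unfolding h_def[abs_def]
  proof (rule continuous_on_cases[OF cl(2,3)])
    show "continuous_on T2 g2" by (rule continuous_on_subset[OF g2(1)]) (use T2 in auto)
    show "\<forall>x. x \<in> T2 \<and> \<not> x a = 0 \<or> x \<in> T0 \<and> x a = 0 \<longrightarrow> g2 x = x"
    proof (intro allI impI)
      fix x assume "x \<in> T2 \<and> \<not> x a = 0 \<or> x \<in> T0 \<and> x a = 0"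
      then have "x \<in> T0" "x a = 0" by (auto simp: T2_def)
      then obtain w where "x \<in> T2" "w \<in> S" "x w = 0" by (auto simp: T0_def T2_def)
      then show "g2 x = x" using g2_id[of x w] by simp
    qed
  qed (rule continuous_on_id)
  then have "continuous_on (T1 \<union> (T2 \<union> T0)) f" unfolding f_def[abs_def]
  proof (intro continuous_on_cases cl closed_Un)
    show "continuous_on T1 g1" by (rule continuous_on_subset[OF g1(1)]) (use T1 in auto)
    show "\<forall>x. x \<in> T1 \<and> \<not> x b = 0 \<or> x \<in> T2 \<union> T0 \<and> x b = 0 \<longrightarrow> g1 x = h x"
    proof (intro allI impI)
      fix x assume "x \<in> T1 \<and> \<not> x b = 0 \<or> x \<in> T2 \<union> T0 \<and> x b = 0"
      then have x: "x \<in> T2 \<union> T0" "x b = 0" by (auto simp: T1_def)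
      then have "x \<in> T1" by (auto simp: T1_def T2_def T0_def)
      moreover obtain w where "w \<in> ?Sa" "x w = 0" using x(1) by (auto simp: T2_def T0_def)
      ultimately have "g1 x = x" by (rule g1_id)
      moreover have "h x = x" using h_id[OF x(1) _ x(2)] by simp
      ultimately show "g1 x = h x" by simp
    qed
  qed
  then have contf: "continuous_on ?T f" unfolding T .
  \<comment> \<open>Each case pairs a vanishing coordinate of \<open>x\<close> with the information
    on \<open>f x\<close> that makes the same coordinate vanish after
    \<open>collapse\<close>.\<close>
  have cases_T: "x b = 0 \<and> f x = g1 x \<and> f x \<in> X1 \<or> x a = 0 \<and> f x = g2 x \<and> f x \<in> X2 \<or>
      (\<exists>w\<in>S. x w = 0 \<and> f x = x \<and> f x \<in> X)" if x: "x \<in> ?T" for x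
  proof (cases "x b = 0 \<or> x a = 0")
    case True
    then show ?thesis
    proof (cases "x b = 0")
      case True
      then have "x \<in> T1" using x by (simp add: T1_def)
      then have "g1 x \<in> X1" using T1 g1(2) by blast
      then show ?thesis using True by (simp add: f_def)
    next
      case False
      then have "x a = 0" using True by simp
      then have "x \<in> T2" using x by (simp add: T2_def)
      then have "g2 x \<in> X2" using T2 g2(2) by blast
      then show ?thesis using False \<open>x a = 0\<close> by (simp add: f_def h_def)
    qed
  next
    case False
    then obtain w where w: "w \<in> S" "x w = 0" using x by (auto simp: simplex_boundary_def)
    have xS: "x \<in> std_simplex ?W" using x by (simp add: simplex_boundary_def)
    have x0: "x v = 0" if "v \<noteq> a" "v \<noteq> b" "v \<notin> S" for v using xS that by (simp add: std_simplex_def)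
    have "{v. x v \<noteq> 0} \<subseteq> {a, b} \<union> (S - {w})"
    proof
      fix v assume "v \<in> {v. x v \<noteq> 0}"
      then show "v \<in> {a, b} \<union> (S - {w})" using x0[of v] w by auto
    qed
    then have "{v. x v \<noteq> 0} \<in> K" by (rule down[OF facets[OF w(1)]])
    moreover have "sum x (P \<union> Q \<union> S) = sum x ?W"
      by (rule sum.mono_neutral_right) (use finite a b x0 in auto)
    ultimately have "x \<in> X" using xS unfolding X_iff std_simplex_def by simp
    then show ?thesis using f_id[OF x w] w by auto
  qed
  have fX: "f ` ?T \<subseteq> X"
  proof (rule image_subsetI)
    show "f x \<in> X" if "x \<in> ?T" for x
      using cases_T[OF that] X1_iff[of "f x"] X2_iff[of "f x"] by auto
  qed
  \<comment> \<open>There are \<open>card S + 2\<close> vertices, so extending over the solid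
    simplex needs exactly the degree \<open>Suc (card S)\<close> assumed for contradiction.\<close>
  have "filling (std_simplex ?W) ?T X"
    by (rule filling_simplex[OF finW cardW fillX])
  then obtain F where F: "continuous_on (std_simplex ?W) F" "F ` std_simplex ?W \<subseteq> X"
    "\<And>x. x \<in> ?T \<Longrightarrow> F x = f x"
    by (rule fillingE[OF _ contf fX]) (rule that; assumption)
  have contc: "continuous_on A collapse" for A
    unfolding collapse_def
  proof (rule continuous_on_coordinatewise_then_product)
    show "continuous_on A (\<lambda>x. if v = a then sum x P else if v = b then sum x Q else if v \<in> S then x v else 0)" for v
      by (cases "v = a"; cases "v = b"; cases "v \<in> S")
         (auto intro!: continuous_intros continuous_on_coordinate_sum)
  qed
  have "contractible ?T"
  proof (rule contractible_of_facet_preserving[OF finW, of a "\<lambda>x. collapse (F x)"])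
    show "continuous_on (std_simplex ?W) (\<lambda>x. collapse (F x))"
      by (rule continuous_on_compose2[OF contc F(1) subset_refl])
    show "(\<lambda>x. collapse (F x)) ` std_simplex ?W \<subseteq> ?T"
      using F(2) collapse_in_boundary by blast
    \<comment> \<open>A point of \<open>X1\<close> has no weight on \<open>Q\<close>, so
      \<open>collapse\<close> gives it coordinate 0 at \<open>b\<close>; likewise for
      \<open>X2\<close> and \<open>a\<close>. Coordinates in \<open>S\<close> are left unchanged by
      \<open>collapse\<close>.\<close>
    show "\<exists>w\<in>?W. x w = 0 \<and> collapse (F x) w = 0" if x: "x \<in> ?T" for x
      using cases_T[OF x]
    proof (elim disjE conjE bexE)
      assume "x b = 0" "f x \<in> X1"
      moreover from this(2) have "sum (f x) Q = 0" unfolding X1_iff by (simp add: sum.neutral)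
      ultimately show ?thesis using ab by (intro bexI[of _ b]) (auto simp: collapse_def F(3)[OF x])
    next
      assume "x a = 0" "f x \<in> X2"
      moreover from this(2) have "sum (f x) P = 0" unfolding X2_iff by (simp add: sum.neutral)
      ultimately show ?thesis using ab by (intro bexI[of _ a]) (auto simp: collapse_def F(3)[OF x])
    next
      fix w assume "w \<in> S" "x w = 0" "f x = x"
      then show ?thesis using ab by (intro bexI[of _ w]) (auto simp: collapse_def F(3)[OF x])
    qed
  qed simp
  then show False
    using not_contractible_simplex_boundary[OF finW] cardW by simp
qed

lemma Conn_X:
  assumes "k_connected (int (card S) - 1) (top_of_set X1)" "k_connected (int (card S) - 1) (top_of_set X2)"
  shows "has_Conn (top_of_set X) (int (card S) - 1)"
proof -
  have fill: "fillable j X1" "fillable j X2" if "j \<le> card S" for j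
    using assms that unfolding k_connected_iff_fillable by auto
  show ?thesis
    unfolding has_Conn_def
  proof (intro conjI allI impI)
    show "k_connected (int (card S) - 1) (top_of_set X)"
      unfolding k_connected_iff_fillable
    proof (intro allI impI)
      show "fillable d X" if "d \<le> card S" for d
        by (rule fillable_X) (use fill that in auto)
    qed
    show "j \<le> int (card S) - 1" if j: "k_connected j (top_of_set X)" for j
    proof (rule ccontr)
      assume *: "\<not> j \<le> int (card S) - 1"
      \<comment> \<open>Here \<open>j \<ge> card S \<ge> 0\<close>, so the conversion to naturals is
        exact and the degrees covered reach \<open>Suc (card S)\<close>.\<close>
      then have "j = int (nat (j + 1)) - 1" by simp
      then have "\<forall>i\<le>nat (j + 1). fillable i X"
        using j k_connected_iff_fillable[of "nat (j + 1)" X] by simp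
      moreover have "Suc (card S) \<le> nat (j + 1)" using * by linarith
      ultimately show False
        using not_fillable_X[OF fill(1)[OF order_refl] fill(2)[OF order_refl]] by simp
    qed
  qed
qed

end

section \<open>Neighbourhood complexes\<close>

lemma isomorphic_complete_graph:
  assumes "graph_isomorphic H (complete_graph n)"
  shows "card (verts H) = n" "\<And>u v. u \<in> verts H \<Longrightarrow> v \<in> verts H \<Longrightarrow> u \<noteq> v \<Longrightarrow> adjacent H u v"
proof -
  obtain f where f: "bij_betw f (verts H) {..<n}"
    and adj: "\<And>u v. u \<in> verts H \<Longrightarrow> v \<in> verts H \<Longrightarrow>
      adjacent H u v \<longleftrightarrow> adjacent (complete_graph n) (f u) (f v)"
    using assms unfolding graph_isomorphic_def by (auto simp: complete_graph_def)
  show "card (verts H) = n" using bij_betw_same_card[OF f] by simp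
  show "adjacent H u v" if "u \<in> verts H" "v \<in> verts H" "u \<noteq> v" for u v
  proof -
    have "f u \<noteq> f v" "f u < n" "f v < n"
      using f that by (auto simp: bij_betw_def inj_on_def)
    then show ?thesis using adj[OF that(1,2)] by (simp add: adjacent_def complete_graph_def)
  qed
qed

lemma adjacent_sym: "adjacent G u v \<longleftrightarrow> adjacent G v u"
  by (simp add: adjacent_def insert_commute)

lemma adjacent_verts:
  assumes "simple_graph G" "adjacent G u v"
  shows "u \<in> verts G" "v \<in> verts G" "u \<noteq> v"
  using assms unfolding simple_graph_def adjacent_def by fastforce+

locale clique_sum =
  fixes G G1 G2 H :: "'a ugraph" and a b :: 'a and n :: nat
  assumes simple: "simple_graph G" "simple_graph G1" "simple_graph G2"
    and union: "G = graph_union G1 G2"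
    and inter: "graph_inter G1 G2 = H"
    and iso: "graph_isomorphic H (complete_graph n)"
    and a: "a \<in> verts G1" and b: "b \<in> verts G2"
    and ab_adj: "\<And>h. h \<in> verts H \<Longrightarrow> adjacent G a h \<and> adjacent G b h"
begin

lemma clique_sum_swap: "clique_sum G G2 G1 H b a n"
  by unfold_locales
     (use simple union inter iso a b ab_adj in
       \<open>auto simp: graph_union_def graph_inter_def Un_commute Int_commute\<close>)

lemma verts_H: "verts H = verts G1 \<inter> verts G2" and verts_G: "verts G = verts G1 \<union> verts G2"
  using inter union by (auto simp: graph_inter_def graph_union_def)

lemma adj_G: "adjacent G u v \<longleftrightarrow> adjacent G1 u v \<or> adjacent G2 u v"
  unfolding union by (simp add: adjacent_def graph_union_def)

lemma clique: "u \<in> verts H \<Longrightarrow> v \<in> verts H \<Longrightarrow> u \<noteq> v \<Longrightarrow> adjacent G1 u v"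
  using isomorphic_complete_graph(2)[OF iso, of u v] inter
  by (auto simp: adjacent_def graph_inter_def)

text \<open>An edge coming from \<open>G2\<close> with both ends in \<open>G1\<close> has both ends
  in \<open>H\<close>, and the clique \<open>H\<close> has that edge in \<open>G1\<close> as
  well.\<close>

lemma adj_G1:
  assumes "adjacent G u v" "u \<in> verts G1" "v \<in> verts G1"
  shows "adjacent G1 u v"
proof (cases "adjacent G1 u v")
  case False
  then have "adjacent G2 u v" using assms(1) adj_G by blast
  then show ?thesis using adjacent_verts[OF simple(3)] clique[of u v] assms(2,3) unfolding verts_H by blast
qed

text \<open>Otherwise \<open>a\<close> would be a vertex of \<open>H\<close> and hence adjacent to
  itself.\<close>

lemma a_notin: "a \<notin> verts G2"
proof
  assume "a \<in> verts G2"
  then have "a \<in> verts H" using a verts_H by blast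
  then show False using ab_adj[of a] adjacent_verts(3)[OF simple(1)] by blast
qed

lemma adj_a: "h \<in> verts H \<Longrightarrow> adjacent G1 h a"
  using ab_adj[of h] a adj_G1[of a h] verts_H adjacent_sym[of G1 a h] by blast

text \<open>A common neighbour inside \<open>G1\<close> still serves, by \<open>adj_G1\<close>. One
  outside \<open>G1\<close> has all its neighbours in \<open>G2\<close>, which forces the simplex
  into \<open>H\<close>; there \<open>a\<close> replaces it as a common neighbour.\<close>

lemma neighbourhood_complex_G1:
  "neighbourhood_complex G1 = {\<sigma> \<in> neighbourhood_complex G. \<sigma> \<inter> (verts G2 - verts H) = {}}"
proof (intro equalityI subsetI)
  fix \<sigma> assume "\<sigma> \<in> neighbourhood_complex G1"
  then show "\<sigma> \<in> {\<sigma> \<in> neighbourhood_complex G. \<sigma> \<inter> (verts G2 - verts H) = {}}"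
    unfolding neighbourhood_complex_def verts_H verts_G adj_G by blast
next
  fix \<sigma> assume "\<sigma> \<in> {\<sigma> \<in> neighbourhood_complex G. \<sigma> \<inter> (verts G2 - verts H) = {}}"
  then obtain w where \<sigma>: "\<sigma> \<subseteq> verts G1" and w: "w \<in> verts G" "\<And>v. v \<in> \<sigma> \<Longrightarrow> adjacent G v w"
    unfolding neighbourhood_complex_def verts_G verts_H by blast
  show "\<sigma> \<in> neighbourhood_complex G1"
  proof (cases "w \<in> verts G1")
    case True
    then have "\<forall>v\<in>\<sigma>. adjacent G1 v w" using \<sigma> w(2) adj_G1 by blast
    then show ?thesis using True \<sigma> unfolding neighbourhood_complex_def by blast
  next
    case False
    have "\<sigma> \<subseteq> verts H"
    proof
      fix v assume v: "v \<in> \<sigma>"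
      then have "adjacent G2 v w" using w(2) adj_G adjacent_verts(2)[OF simple(2)] False by blast
      then show "v \<in> verts H" using adjacent_verts(1)[OF simple(3)] v \<sigma> verts_H by blast
    qed
    then have "\<forall>v\<in>\<sigma>. adjacent G1 v a" using adj_a by blast
    then show ?thesis using \<sigma> a unfolding neighbourhood_complex_def by blast
  qed
qed

lemma glued: "glued_complex (neighbourhood_complex G) (verts G1 - verts H) (verts G2 - verts H) (verts H) a b"
proof
  interpret s: clique_sum G G2 G1 H b a n by (rule clique_sum_swap)
  let ?K = "neighbourhood_complex G" and ?S = "verts H"
  have adjs: "adjacent G v w" if "v \<in> {a, b} \<union> (?S - {w})" "w \<in> ?S" for v w
    using that ab_adj clique adj_G by blast
  have abG: "a \<in> verts G" "b \<in> verts G" "?S \<subseteq> verts G" using a b by (auto simp: verts_G verts_H)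
  show "finite (verts G1 - ?S)" "finite (verts G2 - ?S)" "finite ?S"
    using simple by (auto simp: simple_graph_def verts_H)
  show "(verts G1 - ?S) \<inter> (verts G2 - ?S) = {}" "(verts G1 - ?S) \<inter> ?S = {}" "(verts G2 - ?S) \<inter> ?S = {}"
    by (auto simp: verts_H)
  show "?K \<subseteq> Pow (verts G1 - ?S \<union> (verts G2 - ?S) \<union> ?S)"
    by (auto simp: neighbourhood_complex_def verts_G)
  show "\<tau> \<in> ?K" if "\<sigma> \<in> ?K" "\<tau> \<subseteq> \<sigma>" for \<sigma> \<tau>
    using that unfolding neighbourhood_complex_def by blast
  show "a \<in> verts G1 - ?S" "b \<in> verts G2 - ?S"
    using a b a_notin s.a_notin by (auto simp: verts_H)
  show "?S \<in> ?K"
    using abG adj_a adj_G unfolding neighbourhood_complex_def by blast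
  show "{a, b} \<union> (?S - {w}) \<in> ?K" if "w \<in> ?S" for w
    using that abG adjs[OF _ that] unfolding neighbourhood_complex_def by blast
  show "\<exists>w\<in>?S. w \<notin> \<sigma> \<and> \<sigma> \<union> {a, b} \<union> (?S - {w}) \<in> ?K"
    if s: "\<sigma> \<in> ?K" "\<sigma> \<inter> (verts G1 - ?S) \<noteq> {}" "\<sigma> \<inter> (verts G2 - ?S) \<noteq> {}" for \<sigma>
  proof -
    obtain w where w: "w \<in> verts G" "\<And>v. v \<in> \<sigma> \<Longrightarrow> adjacent G v w" and sub: "\<sigma> \<subseteq> verts G"
      using s(1) unfolding neighbourhood_complex_def by blast
    obtain u1 u2 where u: "u1 \<in> \<sigma>" "u1 \<notin> verts G2" "u2 \<in> \<sigma>" "u2 \<notin> verts G1"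
      using s(2,3) verts_H by blast
    \<comment> \<open>The edge from \<open>w\<close> to \<open>u1\<close>, a vertex outside
      \<open>G2\<close>, must come from \<open>G1\<close>; symmetrically the edge to
      \<open>u2\<close> comes from \<open>G2\<close>. So the common neighbour lies in
      \<open>H\<close>, and it remains a common neighbour after \<open>a\<close>, \<open>b\<close>
      and the rest of \<open>H\<close> are added.\<close>
    have "w \<in> verts G1"
      using w(2)[OF u(1)] u(2) adj_G adjacent_verts(1)[OF simple(3)] adjacent_verts(2)[OF simple(2)] by blast
    moreover have "w \<in> verts G2"
      using w(2)[OF u(3)] u(4) adj_G adjacent_verts(1)[OF simple(2)] adjacent_verts(2)[OF simple(3)] by blast
    ultimately have wS: "w \<in> ?S" using verts_H by blast
    have "w \<notin> \<sigma>" using w(2) adjacent_verts(3)[OF simple(1)] by blast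
    moreover have "\<forall>v\<in>\<sigma> \<union> {a, b} \<union> (?S - {w}). adjacent G v w"
      using w(2) adjs[OF _ wS] by blast
    then have "\<sigma> \<union> {a, b} \<union> (?S - {w}) \<in> ?K"
      using sub abG w(1) unfolding neighbourhood_complex_def by blast
    ultimately show ?thesis using wS by blast
  qed
qed

end

theorem theorem4p3:
  fixes G G1 G2 H :: "'a ugraph" and a b :: 'a and n :: nat
  assumes "n \<ge> 1"
    and "simple_graph G"
    and "subgraph G1 G" and "subgraph G2 G"
    and "G = graph_union G1 G2"
    and "graph_inter G1 G2 = H"
    and "graph_isomorphic H (complete_graph n)"
    and "a \<in> verts G1" and "b \<in> verts G2"
    and "\<forall>h\<in>verts H. adjacent G a h \<and> adjacent G b h"
    and "k_connected (int n - 1) (geometric_realization (neighbourhood_complex G1))"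
    and "k_connected (int n - 1) (geometric_realization (neighbourhood_complex G2))"
  shows "has_Conn (geometric_realization (neighbourhood_complex G)) (int n - 1)"
proof -
  interpret clique_sum G G1 G2 H a b n
    using assms by unfold_locales (auto simp: subgraph_def)
  interpret glued_complex "neighbourhood_complex G" "verts G1 - verts H" "verts G2 - verts H" "verts H" a b
    by (rule glued)
  show ?thesis
    using Conn_X assms(11,12)
    unfolding geometric_realization_eq neighbourhood_complex_G1
      clique_sum.neighbourhood_complex_G1[OF clique_sum_swap] isomorphic_complete_graph(1)[OF iso]
    by blast
qed

end
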